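(* Let $A\in\mathbb{Z}^{r\times n}$, $\mathbf{b}\in\mathbb{Z}^r$ and $M=\begin{pmatrix}\mathrm{id}_n&\mathbf{0}\\ A&-\mathbf{b}\end{pmatrix}$. Let $i_1,\dots,i_r$ be distinct elements of $[r]$ and $j_1,\dots,j_r$ distinct elements of $[n]$. Then, provided both sides are well-defined (i.e. all pivots occurring are nonzero), as rational functions $$\mathop{\mathrm{CT}}_{\lambda_{i_r},j_r}\cdots\mathop{\mathrm{CT}}_{\lambda_{i_2},j_2}\mathop{\mathrm{CT}}_{\lambda_{i_1},j_1}[M]=\mathrm{sgn}\left(A\begin{pmatrix}i_1,\dots,i_r\\ j_1,\dots,j_r\end{pmatrix}\right)\sigma_{K^v}(\mathbf{y}),$$ where $K^v=K^{\cdot}\big(M_r\langle\{j_1,\dots,j_r\}\rangle\big)$ is a shifted simplicial cone.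
   Context: Variables: $\mathbf{y}=(y_1,\dots,y_n)$, $\Lambda=(\lambda_1,\dots,\lambda_r)$. "Fractional" means that rational exponents are allowed. $[n]=\{1,\dots,n\}$. Matrix forms. For $j\in[n]$ and $i\in[r]$ with the $(n+i,j)$ entry of an $(n+r)\times(n+1)$ matrix $O$ nonzero, $O\leftarrow(i,j)$ is obtained from $O$ by adding $-O_{n+i,s}/O_{n+i,j}$ times column $j$ to column $s$ for all $s\neq j$; the entry $O_{n+i,j}$ is the pivot, and row $n+i$ and column $j$ are ignored afterwards. For $I=\{i_1,\dots,i_k\}$, $J=\{j_1,\dots,j_k\}$, $M_k\langle I;J\rangle=M\leftarrow(i_1,j_1)\leftarrow\cdots\leftarrow(i_k,j_k)$, with rows $n+I$ and columns $J$ ignored (up to ignored rows and columns it depends only on the sets $I,J$). $M_r\langle J\rangle$ is $M_r\langle[r];J\rangle$ with rows $n+1,\dots,n+r$ and columns $J$ deleted, an $n\times(n-r+1)$ matrix. $A\begin{pmatrix}i_1,\dots,i_k\\ j_1,\dots,j_k\end{pmatrix}$ is the determinant of the matrix whose $(s,t)$ entry is the $(i_s,j_t)$ entry of $A$. With $\gamma_1,\dots,\gamma_{n+1}$ the columns of $M_k\langle I;J\rangle$, set $[M_k\langle I;J\rangle]=(\mathbf{y},\Lambda)^{\gamma_{n+1}}\big/\prod_{j\in[n]\setminus J}\big(1-(\mathbf{y},\Lambda)^{\gamma_j}\big)$ (entries in ignored rows are omitted, so this is free of $\lambda_i$, $i\in I$). In particular $[M]=\Lambda^{-\mathbf{b}}/\prod_{j=1}^n(1-\Lambda^{A_j}y_j)$,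 with $A_j$ the $j$th column of $A$. The factor indexed by $j$ is called the $j$th denominator factor. The operator $\mathrm{CT}_{\lambda,j}$. Let $F$ be a fractional rational function with pairwise coprime denominator factors indexed by $j$, the $j$th being $1-(u_j\lambda^{b_j})^{p_j}$ with $u_j$ free of $\lambda$, $b_j\in\mathbb{Q}$, and $p_j$ a positive integer. If $b_j\neq0$, replace $\lambda$ by $\lambda^m$ with $m$ a positive integer making all $\lambda$-exponents integral; rewrite each factor with $b_\ell<0$ by $1-x=-x(1-x^{-1})$ so that all factors have the form $1-v_\ell\lambda^{a_\ell}$ with $a_\ell\ge 0$; take the partial fraction decomposition in $\lambda$, $F=P(\lambda)+p(\lambda)\lambda^{-t}+\sum_{\ell:\,a_\ell>0}\frac{A_\ell(\lambda)}{1-v_\ell\lambda^{a_\ell}}$ with $P,p,A_\ell$ polynomials, $\deg p<t$, $\deg A_\ell<a_\ell$; then $\mathrm{CT}_{\lambda,j}F:=A_j(0)$, which does not depend on $m$. When the variable $y_j$ occurs only in $u_j$, $p_j=1$ and $u_j=y_ju_j'$, this equals $\mathrm{sgn}(b_j)\,\mathcal{Z}_{y_j}\big(F\cdot(1-u_j\lambda^{b_j})\big)\big|_{\lambda=u_j^{-1/b_j}}$, where $\mathcal{Z}_{y_j}$ keeps only the terms of a fractional series in which the exponent of $y_j$ is an integer. $\mathcal{Z}_{\mathbf{y}}=\mathcal{Z}_{y_1}\cdots\mathcal{Z}_{y_n}$. In the iterated expression, the remaining denominator factors keep their index at each stage: after $k$ steps one has, up to sign, $\mathcal{Z}_{\mathbf{y}}[M_k\langle\{i_1,\dots,i_k\};\{j_1,\dots,j_k\}\rangle]$,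 which is written with denominator factors $1-\big((\mathbf{y},\Lambda)^{\gamma_j}\big)^{p_j}$, $j\in[n]\setminus\{j_1,\dots,j_k\}$, where $p_j$ is a positive integer making the $\mathbf{y}$-exponents of $\big((\mathbf{y},\Lambda)^{\gamma_j}\big)^{p_j}$ integral. Cones. For an $n\times(m+1)$ rational matrix with columns $w_1,\dots,w_m,v$, $K^{\cdot}(w_1,\dots,w_m,v)=\{v+\sum_ik_iw_i:k_i\in\mathbb{R}_{\ge0}\}$; it is a shifted simplicial cone if $w_1,\dots,w_m$ are linearly independent. $\sigma_S(\mathbf{y})=\sum_{\alpha\in S\cap\mathbb{Z}^n}\mathbf{y}^\alpha$, identified with the rational function it represents. *)

theory Defs
  imports
    "HOL-Library.Poly_Mapping"
    "HOL-Computational_Algebra.Fraction_Field"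
    "HOL-Computational_Algebra.Polynomial"
    "Jordan_Normal_Form.Determinant"
    "Jordan_Normal_Form.DL_Submatrix"
begin

text \<open>
  All indices start at 0. The variables are numbered by natural numbers: for \<open>j < n\<close> the
  variable \<open>j\<close> is $y_j$, and for \<open>i < r\<close> the variable \<open>n + i\<close> is $\lambda_i$.
  A key of type \<open>nat \<Rightarrow>\<^sub>0 rat\<close> is the exponent vector of a monomial with rational exponents, so
  \<open>(nat \<Rightarrow>\<^sub>0 rat) \<Rightarrow>\<^sub>0 'k\<close> is the domain of Laurent polynomials with rational exponents.
\<close>

type_synonym 'k frac_rat_fun = "((nat \<Rightarrow>\<^sub>0 rat) \<Rightarrow>\<^sub>0 'k) fract"

definition monom_fun :: "(nat \<Rightarrow>\<^sub>0 rat) \<Rightarrow> 'k::field_char_0 frac_rat_fun" where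
  "monom_fun e = Fract (Poly_Mapping.single e 1) 1"

definition free_of :: "nat \<Rightarrow> 'k::field_char_0 frac_rat_fun \<Rightarrow> bool" where
  "free_of v F \<longleftrightarrow>
     (\<exists>p q. q \<noteq> 0 \<and> F = Fract p q \<and>
            (\<forall>e \<in> Poly_Mapping.keys p \<union> Poly_Mapping.keys q. Poly_Mapping.lookup e v = 0))"

definition matM :: "nat \<Rightarrow> nat \<Rightarrow> int mat \<Rightarrow> int vec \<Rightarrow> rat mat" where
  "matM n r A b =
     four_block_mat (1\<^sub>m n) (0\<^sub>m n 1) (map_mat of_int A) (mat r 1 (\<lambda>(i, _). - of_int (b $ i)))"

definition pivot_step :: "nat \<Rightarrow> nat \<Rightarrow> nat \<Rightarrow> rat mat \<Rightarrow> rat mat" where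
  "pivot_step n i j X =
     mat (dim_row X) (dim_col X)
       (\<lambda>(a, s). if s = j then X $$ (a, s)
                 else X $$ (a, s) + (- X $$ (n + i, s) / X $$ (n + i, j)) * X $$ (a, j))"

text \<open>
  The matrix $M \leftarrow (i_1,j_1) \leftarrow \cdots \leftarrow (i_k,j_k)$, with \<open>il\<close> and \<open>jl\<close> listing
  $i_1, i_2, \dots$ and $j_1, j_2, \dots$. Ignored rows and columns are kept in the matrix and
  left out wherever it is used.
\<close>
primrec reduced :: "nat \<Rightarrow> rat mat \<Rightarrow> nat list \<Rightarrow> nat list \<Rightarrow> nat \<Rightarrow> rat mat" where
  "reduced n M il jl 0 = M"
| "reduced n M il jl (Suc k) = pivot_step n (il ! k) (jl ! k) (reduced n M il jl k)"

text \<open>The exponent vector of column \<open>j\<close>, without the entries in the ignored rows \<open>n + i\<close>, \<open>i \<in> I\<close>.\<close>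
definition column_exponent :: "nat \<Rightarrow> nat \<Rightarrow> rat mat \<Rightarrow> nat set \<Rightarrow> nat \<Rightarrow> (nat \<Rightarrow>\<^sub>0 rat)" where
  "column_exponent n r X I j =
     (\<Sum>s \<in> {..<n + r} - (+) n ` I. Poly_Mapping.single s (X $$ (s, j)))"

definition bracket ::
  "nat \<Rightarrow> nat \<Rightarrow> rat mat \<Rightarrow> nat set \<Rightarrow> nat set \<Rightarrow> 'k::field_char_0 frac_rat_fun" where
  "bracket n r X I J =
     monom_fun (column_exponent n r X I n) /
       (\<Prod>j \<in> {..<n} - J. 1 - monom_fun (column_exponent n r X I j))"

text \<open>
  \<open>partial_fractions v L u b p F m A\<close>: the polynomials \<open>A l\<close> are the numerators in the partial
  fraction decomposition of \<open>F\<close> with respect to the variable \<open>\<lambda>\<close> numbered \<open>v\<close> and the denominator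
  factors $1 - (u_l \lambda^{b_l})^{p_l}$, \<open>l \<in> L\<close>. Instead of replacing \<open>\<lambda>\<close> by $\lambda^m$ in \<open>F\<close>,
  the polynomials are evaluated at $\lambda^{1/m}$, which gives the same polynomials because
  $\lambda \mapsto \lambda^m$ is a field automorphism fixing all functions free of \<open>\<lambda>\<close>. The rewriting
  $1 - x = -x (1 - x^{-1})$ turns a factor with $b_l < 0$ into one with $w_l = u_l^{-p_l}$.
\<close>
definition partial_fractions ::
  "nat \<Rightarrow> nat set \<Rightarrow> (nat \<Rightarrow> 'k::field_char_0 frac_rat_fun) \<Rightarrow> (nat \<Rightarrow> rat) \<Rightarrow> (nat \<Rightarrow> nat) \<Rightarrow>
   'k frac_rat_fun \<Rightarrow> nat \<Rightarrow> (nat \<Rightarrow> 'k frac_rat_fun poly) \<Rightarrow> bool" where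
  "partial_fractions v L u b p F m A \<longleftrightarrow>
     m > 0 \<and>
     (\<exists>(a :: nat \<Rightarrow> nat) P Q t.
        let x = monom_fun (Poly_Mapping.single v (1 / of_nat m));
            w = (\<lambda>l. if b l < 0 then inverse (u l ^ p l) else u l ^ p l)
        in (\<forall>l \<in> L. of_nat (a l) = \<bar>of_nat m * (of_nat (p l) * b l)\<bar>) \<and>
           (\<forall>i. free_of v (coeff P i)) \<and>
           (\<forall>i. free_of v (coeff Q i)) \<and>
           (\<forall>l \<in> L. \<forall>i. free_of v (coeff (A l) i)) \<and>
           (Q = 0 \<or> Polynomial.degree Q < t) \<and>
           (\<forall>l \<in> L. a l > 0 \<longrightarrow> Polynomial.degree (A l) < a l) \<and>
           F = poly P x + poly Q x / x ^ t +
               (\<Sum>l \<in> {l \<in> L. a l > 0}. poly (A l) x / (1 - w l * x ^ a l)))"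

text \<open>
  Meaningful if \<open>j \<in> L\<close>, \<open>b j \<noteq> 0\<close>, the \<open>u l\<close> are free of the variable \<open>v\<close>, the denominator factors
  are pairwise coprime and they are the denominator factors of \<open>F\<close>; the decomposition then exists
  and the value does not depend on \<open>m\<close>.
\<close>
definition CT ::
  "nat \<Rightarrow> nat \<Rightarrow> nat set \<Rightarrow> (nat \<Rightarrow> 'k::field_char_0 frac_rat_fun) \<Rightarrow> (nat \<Rightarrow> rat) \<Rightarrow> (nat \<Rightarrow> nat) \<Rightarrow>
   'k frac_rat_fun \<Rightarrow> 'k frac_rat_fun" where
  "CT v j L u b p F = (THE c. \<exists>m A. partial_fractions v L u b p F m A \<and> c = poly (A j) 0)"

text \<open>
  The iterated expression after \<open>k\<close> steps. In step \<open>k\<close>, the denominator factor with index \<open>l\<close> is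
  $1 - ((\mathbf{y},\Lambda)^{\gamma_l})^{p_{k,l}}$, where $\gamma_l$ is column \<open>l\<close> of the
  matrix reached after \<open>k\<close> pivots and $p_{k,l}$ is \<open>p k l\<close>.
\<close>
primrec iterated_CT ::
  "nat \<Rightarrow> nat \<Rightarrow> rat mat \<Rightarrow> nat list \<Rightarrow> nat list \<Rightarrow> (nat \<Rightarrow> nat \<Rightarrow> nat) \<Rightarrow> nat \<Rightarrow>
   'k::field_char_0 frac_rat_fun" where
  "iterated_CT n r M il jl p 0 = bracket n r M {} {}"
| "iterated_CT n r M il jl p (Suc k) =
     (let v = n + il ! k;
          e = column_exponent n r (reduced n M il jl k) (set (take k il));
          b = (\<lambda>l. Poly_Mapping.lookup (e l) v);
          u = (\<lambda>l. monom_fun (e l - Poly_Mapping.single v (b l)))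
      in CT v (jl ! k) ({..<n} - set (take k jl)) u b (p k) (iterated_CT n r M il jl p k))"

text \<open>The last column of \<open>N\<close> is the apex, the other columns are the generators.\<close>

definition shifted_cone :: "rat mat \<Rightarrow> real vec set" where
  "shifted_cone N =
     {vec (dim_row N) (\<lambda>s. of_rat (N $$ (s, m)) + (\<Sum>i<m. k i * of_rat (N $$ (s, i)))) | k m.
        m = dim_col N - 1 \<and> (\<forall>i<m. k i \<ge> 0)}"

definition is_simplicial :: "rat mat \<Rightarrow> bool" where
  "is_simplicial N \<longleftrightarrow>
     (\<forall>k :: nat \<Rightarrow> real.
        (\<forall>s < dim_row N. (\<Sum>i < dim_col N - 1. k i * of_rat (N $$ (s, i))) = 0) \<longrightarrow>
        (\<forall>i < dim_col N - 1. k i = 0))"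

definition lattice_exponent :: "int vec \<Rightarrow> (nat \<Rightarrow>\<^sub>0 rat)" where
  "lattice_exponent \<alpha> = (\<Sum>s < dim_vec \<alpha>. Poly_Mapping.single s (of_int (\<alpha> $ s)))"

text \<open>
  Formal series, possibly infinite in all directions, are functions from exponents to
  coefficients. They form a module over the Laurent polynomials, and a rational function \<open>F\<close> is
  represented by the series \<open>f\<close> if \<open>F = p / q\<close> with \<open>q \<noteq> 0\<close> and \<open>q f = p\<close>; there is at most one such \<open>F\<close>.
\<close>
definition represents ::
  "((nat \<Rightarrow>\<^sub>0 rat) \<Rightarrow> 'k::field_char_0) \<Rightarrow> 'k frac_rat_fun \<Rightarrow> bool" where
  "represents f F \<longleftrightarrow>
     (\<exists>p q. q \<noteq> 0 \<and> F = Fract p q \<and>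
        (\<forall>e. (\<Sum>d \<in> Poly_Mapping.keys q. Poly_Mapping.lookup q d * f (e - d)) =
             Poly_Mapping.lookup p e))"

definition lattice_series :: "nat \<Rightarrow> real vec set \<Rightarrow> (nat \<Rightarrow>\<^sub>0 rat) \<Rightarrow> 'k::field_char_0" where
  "lattice_series n S e =
     (if \<exists>\<alpha> \<in> carrier_vec n. map_vec of_int \<alpha> \<in> S \<and> e = lattice_exponent \<alpha> then 1 else 0)"

definition lattice_sigma :: "nat \<Rightarrow> real vec set \<Rightarrow> 'k::field_char_0 frac_rat_fun" where
  "lattice_sigma n S = (THE F. represents (lattice_series n S) F)"

end

theory Submission
  imports Defs
begin

text \<open>
  Series that may be infinite in all directions form a module over the Laurent polynomials. Write
  $X_l$ for the monomial of the $l$th denominator factor $1 - X_l$. Modulo everything that has no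
  pole at $X_j = 1$, the partial fraction decomposition expresses $F$ by the summand
  $A_j / (1 - X_j)$. Multiplying by the Dirac comb $\sum_{k \in \mathbb{Z}} X_j^k$, which is
  annihilated by $1 - X_j$, kills everything else, and since $A_j$ has small degree in $\lambda$, the
  part of $A_j \sum_k X_j^k$ that is constant in $\lambda$ is $A_j(0)$. Hence if $F$ is represented by
  the indicator series of the integral points of a cone, then $\pm A_j(0)$ is represented by the
  indicator series of those points $\gamma_{n+1} + \sum_l k_l \gamma_l$ with $k_l \ge 0$ for
  $l \ne j$, $k_j$ arbitrary, and $\lambda$-exponent $0$. Solving for $k_j$ is a pivot step, so
  this is again the set of integral points of a cone, the one for the next matrix. The remaining
  denominators can be cancelled because a series with two periods $X_j$ and $X_l$ has a period free
  of $\lambda$. The sign is the product of the signs of the pivots, which is the sign of the minor.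
\<close>

section \<open>Laurent polynomials acting on formal series\<close>

text \<open>Pivot exponents may have either sign, so no single direction of expansion suits all
  steps. Series infinite in all directions avoid the choice, but they can be neither multiplied nor
  divided: a series determines its rational function, not conversely, and clearing a denominator
  determines a series only up to torsion. The constant-term projection is linear only over
  polynomials free of the current \<lambda>, hence the repeated effort to replace denominators by
  ones free of that variable. The operator Z of the \<open>y\<close> variables never appears
  explicitly. It is hidden in the demand that points of a cone have integral exponents in the
  \<open>y\<close> variables, whereas exponents of \<lambda> may stay fractional. Coprimality of the
  factors comes from the fact that, among the remaining factors, \<open>y_l\<close> occurs in the
  \<open>l\<close>th one alone and with exponent 1. The same fact lets the coefficient of generator
  \<open>l\<close> be read off from a point as its coordinate \<open>l\<close>.\<close>

definition act :: "('a::ab_group_add \<Rightarrow>\<^sub>0 'k::comm_ring_1) \<Rightarrow> ('a \<Rightarrow> 'k) \<Rightarrow> 'a \<Rightarrow> 'k" where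
  "act p f e = (\<Sum>d\<in>Poly_Mapping.keys p. Poly_Mapping.lookup p d * f (e - d))"

lemma act_superset:
  assumes "finite S" "Poly_Mapping.keys p \<subseteq> S"
  shows "act p f e = (\<Sum>d\<in>S. Poly_Mapping.lookup p d * f (e - d))"
  unfolding act_def using assms
  by (intro sum.mono_neutral_left) (auto simp: in_keys_iff)

lemma act_zero [simp]: "act 0 f = (\<lambda>_. 0)"
  by (auto simp: act_def fun_eq_iff)

lemma act_single: "act (Poly_Mapping.single d c) f = (\<lambda>e. c * f (e - d))"
  by (cases "c = 0") (auto simp: act_def fun_eq_iff)

lemma act_one [simp]: "act 1 f = f"
  using act_single[of 0 1 f] by (simp add: fun_eq_iff)

lemma act_add: "act (p + q) f = (\<lambda>e. act p f e + act q f e)"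
proof
  fix e
  have *: "finite (Poly_Mapping.keys p \<union> Poly_Mapping.keys q)" by simp
  show "act (p + q) f e = act p f e + act q f e"
    using keys_add[of p q]
    by (simp add: act_superset[OF *] lookup_add distrib_right sum.distrib)
qed

lemma act_uminus: "act (- p) f = (\<lambda>e. - act p f e)"
proof
  fix e
  have "act (p + (- p)) f e = 0" by simp
  then show "act (- p) f e = - act p f e"
    unfolding act_add by (simp add: add_eq_0_iff)
qed

lemma act_minus: "act (p - q) f = (\<lambda>e. act p f e - act q f e)"
  using act_add[of p "- q" f] by (simp add: act_uminus)

lemma act_sum: "act (\<Sum>i\<in>I. p i) f = (\<lambda>e. \<Sum>i\<in>I. act (p i) f e)"
  by (induction I rule: infinite_finite_induct) (auto simp: act_add)

lemma act_fun_add: "act p (\<lambda>e. f e + g e) = (\<lambda>e. act p f e + act p g e)"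
  by (simp add: act_def distrib_left sum.distrib fun_eq_iff)

lemma act_fun_minus: "act p (\<lambda>e. f e - g e) = (\<lambda>e. act p f e - act p g e)"
  by (simp add: act_def right_diff_distrib sum_subtractf fun_eq_iff)

lemma act_fun_scale: "act p (\<lambda>e. c * f e) = (\<lambda>e. c * act p f e)"
  by (simp add: act_def sum_distrib_left mult_ac fun_eq_iff)

lemma act_fun_zero [simp]: "act p (\<lambda>_. 0) = (\<lambda>_. 0)"
  by (simp add: act_def fun_eq_iff)

lemma sum_single_keys:
  "(\<Sum>d\<in>Poly_Mapping.keys p. Poly_Mapping.single d (Poly_Mapping.lookup p d)) = p"
  by (rule poly_mapping_eqI)
     (auto simp: lookup_sum lookup_single when_def sum.delta in_keys_iff if_distrib cong: if_cong)

lemma act_conv_sum_single: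
  "act p f = (\<lambda>e. \<Sum>d\<in>Poly_Mapping.keys p. act (Poly_Mapping.single d (Poly_Mapping.lookup p d)) f e)"
  unfolding act_single by (simp add: act_def fun_eq_iff)

lemma act_mult: "act (p * q) f = act p (act q f)"
proof -
  have single: "act (Poly_Mapping.single d c * q) f = act (Poly_Mapping.single d c) (act q f)" for d c
  proof -
    have "Poly_Mapping.single d c * q =
        (\<Sum>d'\<in>Poly_Mapping.keys q. Poly_Mapping.single (d + d') (c * Poly_Mapping.lookup q d'))"
      by (subst (1) sum_single_keys[of q, symmetric]) (simp add: sum_distrib_left mult_single)
    then show ?thesis
      by (simp add: act_sum act_single act_def[of q] sum_distrib_left mult.assoc diff_diff_eq fun_eq_iff)
  qed
  have "act (p * q) f =
      act (\<Sum>d\<in>Poly_Mapping.keys p. Poly_Mapping.single d (Poly_Mapping.lookup p d) * q) f"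
    by (simp add: sum_distrib_right[symmetric] sum_single_keys)
  also have "\<dots> = act p (act q f)"
    by (simp add: act_sum single flip: act_conv_sum_single)
  finally show ?thesis .
qed

text \<open>Polynomials embed into the series by acting on the delta series at exponent 0. Hence
  \<open>act_lookup\<close> is an instance of \<open>act_mult\<close>.\<close>

lemma lookup_eq_act: "Poly_Mapping.lookup p = act p (\<lambda>e. 1 when e = 0)"
  by (auto simp: act_def when_def in_keys_iff fun_eq_iff if_distrib sum.delta cong: if_cong)

lemma act_lookup: "act p (Poly_Mapping.lookup q) = Poly_Mapping.lookup (p * q)"
  by (simp add: lookup_eq_act[of q] lookup_eq_act[of "p * q"] act_mult)

lemma act_commute: "act p (act q f) = act q (act p f)"
  by (metis act_mult mult.commute)

section \<open>Constant-term projection and bounds on the exponents of one variable\<close>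

definition restrict_free :: "nat \<Rightarrow> ((nat \<Rightarrow>\<^sub>0 rat) \<Rightarrow> 'k::zero) \<Rightarrow> (nat \<Rightarrow>\<^sub>0 rat) \<Rightarrow> 'k" where
  "restrict_free v f e = (if Poly_Mapping.lookup e v = 0 then f e else 0)"

text \<open>Three kinds of \<open>K\<close> matter: \<open>{0}\<close> for freeness of
  \<open>v\<close>, an open interval for the numerator terms that disappear in the constant term,
  and \<open>UNIV\<close> for no restriction.\<close>

definition keys_in :: "nat \<Rightarrow> rat set \<Rightarrow> ((nat \<Rightarrow>\<^sub>0 rat) \<Rightarrow>\<^sub>0 'k::zero) \<Rightarrow> bool" where
  "keys_in v K p \<longleftrightarrow> (\<forall>e\<in>Poly_Mapping.keys p. Poly_Mapping.lookup e v \<in> K)"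

lemma keys_in_add: "keys_in v K p \<Longrightarrow> keys_in v K q \<Longrightarrow> keys_in v K (p + q)"
  for p q :: "(nat \<Rightarrow>\<^sub>0 rat) \<Rightarrow>\<^sub>0 'k::comm_ring_1"
  using keys_add[of p q] by (auto simp: keys_in_def)

lemma keys_in_mult:
  fixes p q :: "(nat \<Rightarrow>\<^sub>0 rat) \<Rightarrow>\<^sub>0 'k::comm_ring_1"
  assumes "keys_in v K p" "keys_in v K' q" "\<And>a b. a \<in> K \<Longrightarrow> b \<in> K' \<Longrightarrow> a + b \<in> K''"
  shows "keys_in v K'' (p * q)"
  using keys_mult[of p q] assms by (fastforce simp: keys_in_def lookup_add)

lemma keys_in_single: "Poly_Mapping.lookup e v \<in> K \<Longrightarrow> keys_in v K (Poly_Mapping.single e c)"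
  by (simp add: keys_in_def)

lemma keys_in_one: "0 \<in> K \<Longrightarrow> keys_in v K 1"
  by (simp add: keys_in_def)

lemma keys_in_uminus: "keys_in v K p \<Longrightarrow> keys_in v K (- p)"
  for p :: "(nat \<Rightarrow>\<^sub>0 rat) \<Rightarrow>\<^sub>0 'k::comm_ring_1"
  by (simp add: keys_in_def in_keys_iff)

text \<open>Shifting by an exponent free of \<open>v\<close> preserves the \<open>v\<close> exponent
  of every term, so the projection commutes with such polynomials.\<close>

lemma restrict_free_act:
  assumes "keys_in v {0} p"
  shows "restrict_free v (act p f) = act p (restrict_free v f)"
  using assms by (auto simp: restrict_free_def act_def keys_in_def lookup_minus fun_eq_iff)

section \<open>Rational functions\<close>

lemma represents_act:
  "represents f F \<longleftrightarrow> (\<exists>p q. q \<noteq> 0 \<and> F = Fract p q \<and> act q f = Poly_Mapping.lookup p)"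
  by (simp add: represents_def act_def fun_eq_iff)

text \<open>Applying both denominators to the one series \<open>f\<close>, in either order, equates
  the two cross products.\<close>

lemma represents_unique:
  assumes "represents f F" "represents f F'"
  shows "F = F'"
proof -
  obtain p q where 1: "q \<noteq> 0" "F = Fract p q" "act q f = Poly_Mapping.lookup p"
    using assms(1) by (auto simp: represents_act)
  obtain p' q' where 2: "q' \<noteq> 0" "F' = Fract p' q'" "act q' f = Poly_Mapping.lookup p'"
    using assms(2) by (auto simp: represents_act)
  have "Poly_Mapping.lookup (q' * p) = Poly_Mapping.lookup (q * p')"
    by (simp flip: act_lookup 1 2 add: act_commute)
  then have "q' * p = q * p'" by simp
  then show ?thesis
    using 1 2 by (simp add: eq_fract mult.commute)
qed

abbreviation emb :: "((nat \<Rightarrow>\<^sub>0 rat) \<Rightarrow>\<^sub>0 'k::field_char_0) \<Rightarrow> 'k frac_rat_fun" where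
  "emb p \<equiv> Fract p 1"

lemma emb_simps:
  "emb (p + q) = emb p + emb q" "emb (p - q) = emb p - emb q" "emb (p * q) = emb p * emb q"
  "emb (- p) = - emb p" "emb 0 = 0" "emb 1 = 1"
  by (simp_all add: Zero_fract_def One_fract_def)

lemma emb_eq_iff [simp]: "emb p = emb q \<longleftrightarrow> p = q"
  by (simp add: eq_fract)

lemma emb_eq_0_iff [simp]: "emb p = 0 \<longleftrightarrow> p = 0"
  by (simp add: Zero_fract_def eq_fract)

lemma emb_prod: "emb (\<Prod>i\<in>I. p i) = (\<Prod>i\<in>I. emb (p i))"
  by (induction I rule: infinite_finite_induct) (auto simp: emb_simps)

lemma emb_sum: "emb (\<Sum>i\<in>I. p i) = (\<Sum>i\<in>I. emb (p i))"
  by (induction I rule: infinite_finite_induct) (auto simp: emb_simps)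

lemma represents_emb:
  assumes "q \<noteq> 0" "act q f = Poly_Mapping.lookup p"
  shows "represents f (emb p / emb q)"
  using assms unfolding represents_act by (intro exI[of _ p] exI[of _ q]) simp

lemma represents_scale:
  assumes "represents f F"
  shows "represents (\<lambda>e. c * f e) (emb (Poly_Mapping.single 0 c) * F)"
proof -
  obtain p q where 1: "q \<noteq> 0" "F = Fract p q" "act q f = Poly_Mapping.lookup p"
    using assms(1) by (auto simp: represents_act)
  have "act q (\<lambda>e. c * f e) = Poly_Mapping.lookup (Poly_Mapping.single 0 c * p)"
    by (simp add: act_fun_scale 1 act_single flip: act_lookup)
  with 1 show ?thesis
    unfolding represents_act by (intro exI[of _ "Poly_Mapping.single 0 c * p"] exI[of _ q]) simp
qed

lemma monom_fun_add: "monom_fun (a + b) = monom_fun a * monom_fun b"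
  by (simp add: monom_fun_def mult_single)

lemma monom_fun_0 [simp]: "monom_fun 0 = 1"
  by (simp add: monom_fun_def One_fract_def)

lemma single_one_ne_0 [simp]: "Poly_Mapping.single a (1 :: 'k::zero_neq_one) \<noteq> 0"
  by (metis lookup_single_eq lookup_zero zero_neq_one)

lemma monom_fun_neq_0 [simp]: "monom_fun a \<noteq> 0"
  by (simp add: monom_fun_def)

lemma monom_fun_eq_iff [simp]:
  "(monom_fun a :: 'k::field_char_0 frac_rat_fun) = monom_fun b \<longleftrightarrow> a = b"
  by (simp add: monom_fun_def)
     (metis lookup_single_eq lookup_single_not_eq zero_neq_one)

lemma monom_fun_uminus: "monom_fun (- a) = inverse (monom_fun a)"
proof -
  have "monom_fun (- a) * monom_fun a = (1 :: 'a frac_rat_fun)"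
    by (simp flip: monom_fun_add)
  then show ?thesis by (metis inverse_unique mult.commute)
qed

definition scl :: "rat \<Rightarrow> (nat \<Rightarrow>\<^sub>0 rat) \<Rightarrow> (nat \<Rightarrow>\<^sub>0 rat)" where
  "scl c e = Poly_Mapping.map ((*) c) e"

lemma lookup_scl [simp]: "Poly_Mapping.lookup (scl c e) i = c * Poly_Mapping.lookup e i"
  by (simp add: scl_def map.rep_eq when_def)

lemma scl_simps:
  "scl 0 e = 0" "scl 1 e = e" "scl (a + b) e = scl a e + scl b e" "scl (a - b) e = scl a e - scl b e"
  "scl (- a) e = - scl a e" "scl a (scl b e) = scl (a * b) e"
  by (auto intro!: poly_mapping_eqI simp: lookup_add lookup_minus algebra_simps)

lemma monom_fun_scl_of_nat: "monom_fun (scl (of_nat n) e) = monom_fun e ^ n"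
  by (induction n) (auto simp: scl_simps monom_fun_add)

section \<open>Functions that become polynomial after multiplication by a function free of a variable\<close>

text \<open>Numerators in a partial fraction decomposition have rational functions as coefficients,
  but only polynomials act on series. A denominator \<open>D\<close> free of \<open>v\<close>
  repairs this without disturbing the \<open>v\<close> exponents recorded by
  \<open>K\<close>.\<close>

definition clearable :: "nat \<Rightarrow> rat set \<Rightarrow> 'k::field_char_0 frac_rat_fun \<Rightarrow> bool" where
  "clearable v K F \<longleftrightarrow> (\<exists>D B. D \<noteq> 0 \<and> keys_in v {0} D \<and> keys_in v K B \<and> emb D * F = emb B)"

lemma clearable_mono: "clearable v K F \<Longrightarrow> K \<subseteq> K' \<Longrightarrow> clearable v K' F"
  unfolding clearable_def keys_in_def by blast

lemma free_of_iff_clearable: "free_of v F \<longleftrightarrow> clearable v {0} F"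
proof
  assume "free_of v F"
  then obtain p q where pq: "q \<noteq> 0" "F = Fract p q"
    "\<forall>e \<in> Poly_Mapping.keys p \<union> Poly_Mapping.keys q. Poly_Mapping.lookup e v = 0"
    unfolding free_of_def by blast
  have "emb q * F = emb p"
    using pq by (simp add: eq_fract)
  with pq show "clearable v {0} F"
    unfolding clearable_def keys_in_def by (intro exI[of _ q] exI[of _ p]) simp
next
  assume "clearable v {0} F"
  then obtain D B where DB: "D \<noteq> 0" "keys_in v {0} D" "keys_in v {0} B" "emb D * F = emb B"
    unfolding clearable_def by blast
  then have "F = emb B / emb D" by (simp only: eq_divide_eq emb_eq_0_iff) (simp add: mult.commute)
  with DB show "free_of v F"
    unfolding free_of_def keys_in_def by (intro exI[of _ B] exI[of _ D]) auto
qed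

lemma clearable_add:
  assumes "clearable v K F" "clearable v K G"
  shows "clearable v K (F + G)"
proof -
  obtain D B where 1: "D \<noteq> 0" "keys_in v {0} D" "keys_in v K B" "emb D * F = emb B"
    using assms(1) unfolding clearable_def by blast
  obtain D' B' where 2: "D' \<noteq> 0" "keys_in v {0} D'" "keys_in v K B'" "emb D' * G = emb B'"
    using assms(2) unfolding clearable_def by blast
  have "emb (D * D') * (F + G) = emb D' * (emb D * F) + emb D * (emb D' * G)"
    by (simp only: emb_simps) (simp only: algebra_simps)
  also have "\<dots> = emb (D' * B + D * B')"
    by (simp only: 1 2 emb_simps)
  finally have 3: "emb (D * D') * (F + G) = emb (D' * B + D * B')" .
  show ?thesis
    unfolding clearable_def
    by (rule exI[of _ "D * D'"], rule exI[of _ "D' * B + D * B'"], intro conjI 3 keys_in_add)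
       (use 1 2 in \<open>auto intro: keys_in_mult\<close>)
qed

lemma clearable_mult:
  assumes "clearable v K F" "clearable v K' G" "\<And>a b. a \<in> K \<Longrightarrow> b \<in> K' \<Longrightarrow> a + b \<in> K''"
  shows "clearable v K'' (F * G)"
proof -
  obtain D B where 1: "D \<noteq> 0" "keys_in v {0} D" "keys_in v K B" "emb D * F = emb B"
    using assms(1) unfolding clearable_def by blast
  obtain D' B' where 2: "D' \<noteq> 0" "keys_in v {0} D'" "keys_in v K' B'" "emb D' * G = emb B'"
    using assms(2) unfolding clearable_def by blast
  have "emb (D * D') * (F * G) = (emb D * F) * (emb D' * G)"
    by (simp only: emb_simps) (simp only: algebra_simps)
  also have "\<dots> = emb (B * B')"
    by (simp only: 1 2 emb_simps)
  finally have 3: "emb (D * D') * (F * G) = emb (B * B')" .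
  show ?thesis
    unfolding clearable_def
    by (rule exI[of _ "D * D'"], rule exI[of _ "B * B'"], intro conjI 3)
       (use 1 2 assms(3) in \<open>auto intro: keys_in_mult\<close>)
qed

lemma clearable_emb: "keys_in v K B \<Longrightarrow> clearable v K (emb B)"
  unfolding clearable_def by (intro exI[of _ 1] exI[of _ B]) (auto simp: keys_in_def)

lemma clearable_monom: "Poly_Mapping.lookup e v \<in> K \<Longrightarrow> clearable v K (monom_fun e)"
  unfolding monom_fun_def by (intro clearable_emb keys_in_single)

lemma clearable_0 [simp]: "clearable v K 0"
  using clearable_emb[of v K 0] by (simp add: keys_in_def emb_simps)

lemma clearable_uminus: "clearable v K F \<Longrightarrow> clearable v K (- F)"
  using clearable_mult[of v "{0}" "emb (- 1)" K F K] clearable_emb[of v "{0}" "- 1"]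
  by (simp add: keys_in_uminus keys_in_one emb_simps)

lemma clearable_sum: "(\<And>i. i \<in> I \<Longrightarrow> clearable v K (F i)) \<Longrightarrow> clearable v K (\<Sum>i\<in>I. F i)"
  by (induction I rule: infinite_finite_induct) (auto intro: clearable_add)

lemma clearable_inverse_emb:
  "D \<noteq> 0 \<Longrightarrow> keys_in v {0} D \<Longrightarrow> clearable v {0} (inverse (emb D))"
  unfolding clearable_def
  by (intro exI[of _ D] exI[of _ 1]) (simp add: keys_in_def One_fract_def eq_fract)

lemma clearable_power:
  assumes "clearable v K F" "0 \<in> K" "\<And>a b. a \<in> K \<Longrightarrow> b \<in> K \<Longrightarrow> a + b \<in> K"
  shows "clearable v K (F ^ i)"
proof (induction i)
  case 0
  then show ?case
    using clearable_emb[of v K 1] assms(2) by (simp add: keys_in_one emb_simps)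
next
  case (Suc i)
  then show ?case using clearable_mult[OF assms(1) Suc] assms(3) by auto
qed

lemma clearable_UNIV_mult: "clearable v UNIV F \<Longrightarrow> clearable v UNIV G \<Longrightarrow> clearable v UNIV (F * G)"
  by (erule clearable_mult) auto

lemma clearable_UNIV_poly:
  assumes "\<And>i. free_of v (coeff P i)" "clearable v UNIV x"
  shows "clearable v UNIV (poly P x)"
  unfolding poly_altdef
  by (intro clearable_sum clearable_UNIV_mult clearable_power assms)
     (use assms in \<open>auto simp: free_of_iff_clearable intro: clearable_mono\<close>)

lemma free_of_add: "free_of v F \<Longrightarrow> free_of v G \<Longrightarrow> free_of v (F + G)"
  by (simp add: free_of_iff_clearable clearable_add)

lemma free_of_mult: "free_of v F \<Longrightarrow> free_of v G \<Longrightarrow> free_of v (F * G)"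
  unfolding free_of_iff_clearable by (erule clearable_mult) auto

lemma free_of_0 [simp]: "free_of v 0"
  by (simp add: free_of_iff_clearable)

lemma free_of_monom: "Poly_Mapping.lookup e v = 0 \<Longrightarrow> free_of v (monom_fun e)"
  by (simp add: free_of_iff_clearable clearable_monom)

section \<open>Periodic series\<close>

definition periodic :: "('a::ab_group_add \<Rightarrow> 'k) \<Rightarrow> 'a \<Rightarrow> bool" where
  "periodic h e \<longleftrightarrow> (\<forall>x. h (x - e) = h x)"

lemma periodic_iff_act:
  fixes h :: "'a::ab_group_add \<Rightarrow> 'k::comm_ring_1"
  shows "periodic h e \<longleftrightarrow> act (1 - Poly_Mapping.single e 1) h = (\<lambda>_. 0)"
  by (auto simp: periodic_def act_minus act_single fun_eq_iff)

lemma periodic_0: "periodic h 0"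
  by (simp add: periodic_def)

lemma periodic_add: "periodic h a \<Longrightarrow> periodic h b \<Longrightarrow> periodic h (a + b)"
  by (simp add: periodic_def flip: diff_diff_eq)

lemma periodic_uminus: "periodic h a \<Longrightarrow> periodic h (- a)"
  unfolding periodic_def by (metis add_diff_cancel diff_minus_eq_add)

text \<open>Stated for any predicate because it serves both the periods of a series and the
  exponents called \<open>good\<close> in the existence proof for partial fractions.\<close>

lemma int_multiple_closed:
  assumes "S 0" "\<And>a b. S a \<Longrightarrow> S b \<Longrightarrow> S (a + b)" "\<And>a. S a \<Longrightarrow> S (- a)" "S e"
  shows "S (scl (of_int k) e)"
proof (induction k rule: int_induct[where k = 0])
  case base
  then show ?case using assms(1) by (simp add: scl_simps)
next
  case (step1 i)
  then show ?case using assms(2)[OF _ assms(4)] by (simp add: scl_simps)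
next
  case (step2 i)
  then show ?case using assms(2)[OF _ assms(3)[OF assms(4)]] by (simp add: scl_simps)
qed

lemma periodic_scl_int: "periodic h e \<Longrightarrow> periodic h (scl (of_int k) e)"
  by (rule int_multiple_closed[where S = "periodic h"]) (auto intro: periodic_0 periodic_add periodic_uminus)

lemma periodic_act:
  fixes h :: "'a::ab_group_add \<Rightarrow> 'k::comm_ring_1"
  shows "periodic h e \<Longrightarrow> periodic (act p h) e"
  by (simp add: periodic_iff_act act_commute[of _ p])

section \<open>Commensurability and common denominators of exponents\<close>

lemma rat_linear_relation:
  fixes a b :: rat
  obtains s t :: int where "of_int s * a + of_int t * b = 0" "s \<noteq> 0 \<or> t \<noteq> 0"
proof (cases "a = 0")
  case True
  then show ?thesis using that[of 1 0] by simp
next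
  case False
  obtain x y where a: "quotient_of a = (x, y)" by force
  obtain x' y' where b: "quotient_of b = (x', y')" by force
  have xy: "a = of_int x / of_int y" "b = of_int x' / of_int y'" "y > 0" "y' > 0"
    using a b by (auto intro: quotient_of_div quotient_of_denom_pos)
  have "of_int (x' * y) * a + of_int (- x * y') * b = 0"
    using xy(3,4) unfolding xy(1,2) by simp
  then show ?thesis
    using False xy by (intro that[of "x' * y" "- x * y'"]) auto
qed

lemma single_eq_1_iff [simp]: "Poly_Mapping.single a (1 :: 'k::zero_neq_one) = 1 \<longleftrightarrow> a = 0"
proof
  assume "Poly_Mapping.single a (1 :: 'k) = 1"
  then have "Poly_Mapping.lookup (Poly_Mapping.single a (1 :: 'k)) a = Poly_Mapping.lookup 1 a"
    by simp
  then show "a = 0" by (auto simp: lookup_one when_def split: if_splits)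
qed simp

lemma common_denominator:
  fixes S :: "rat set"
  assumes "finite S"
  obtains m :: nat where "m > 0" "\<And>s. s \<in> S \<Longrightarrow> of_nat m * s \<in> \<int>"
  using assms
proof (induction S arbitrary: thesis rule: finite_induct)
  case empty
  show ?case by (rule empty.prems(1)[of 1]) auto
next
  case (insert s S)
  obtain m :: nat where m: "m > 0" "\<And>s. s \<in> S \<Longrightarrow> of_nat m * s \<in> \<int>"
    using insert.IH by blast
  obtain k l :: int where kl: "quotient_of s = (k, l)" by force
  then have s: "s = of_int k / of_int l" "l > 0"
    by (auto intro: quotient_of_div quotient_of_denom_pos)
  show ?case
  proof (rule insert.prems[of "m * nat l"])
    show "m * nat l > 0" using m s by simp
    fix s' assume "s' \<in> insert s S"
    then show "of_nat (m * nat l) * s' \<in> \<int>"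
    proof
      assume "s' = s"
      then have "of_nat (m * nat l) * s' = of_nat m * (of_int l * s)"
        using s(2) by (simp add: of_nat_nat)
      also have "of_int l * s = of_int k"
        using s by simp
      also have "of_nat m * of_int k = (of_int (int m * k) :: rat)"
        by simp
      finally have "of_nat (m * nat l) * s' = of_int (int m * k)" .
      then show ?thesis by (simp only: Ints_of_int)
    next
      assume "s' \<in> S"
      then have "of_int l * (of_nat m * s') \<in> \<int>"
        using m by (intro Ints_mult[OF Ints_of_int]) auto
      also have "of_int l * (of_nat m * s') = of_nat (m * nat l) * s'"
        using s by (simp add: of_nat_nat)
      finally show ?thesis .
    qed
  qed
qed

section \<open>One constant term extraction\<close>

text \<open>\<open>G l\<close> is the exponent vector of the monomial whose \<open>p l\<close>th
  power stands in factor \<open>l\<close>. By \<open>diag\<close>, among the factors in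
  \<open>L\<close> the variable \<open>l\<close> occurs in this one alone, with exponent 1; this is
  the source of coprimality.\<close>

locale ct_step =
  fixes v j :: nat and L :: "nat set" and G :: "nat \<Rightarrow> (nat \<Rightarrow>\<^sub>0 rat)" and p :: "nat \<Rightarrow> nat"
  assumes finite_L: "finite L" and j_in_L: "j \<in> L" and v_notin_L: "v \<notin> L"
    and p_pos: "l \<in> L \<Longrightarrow> p l > 0"
    and diag: "l \<in> L \<Longrightarrow> l' \<in> L \<Longrightarrow> Poly_Mapping.lookup (G l) l' = (if l = l' then 1 else 0)"
    and pivot: "Poly_Mapping.lookup (G j) v \<noteq> 0"
begin

definition b :: "nat \<Rightarrow> rat" where
  "b l = Poly_Mapping.lookup (G l) v"

definition u :: "nat \<Rightarrow> 'k::field_char_0 frac_rat_fun" where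
  "u l = monom_fun (G l - Poly_Mapping.single v (b l))"

definition d :: "nat \<Rightarrow> (nat \<Rightarrow>\<^sub>0 rat)" where
  "d l = scl (of_nat (p l)) (G l)"

definition den :: "nat set \<Rightarrow> (nat \<Rightarrow>\<^sub>0 rat) \<Rightarrow>\<^sub>0 'k::field_char_0" where
  "den L' = (\<Prod>l\<in>L'. 1 - Poly_Mapping.single (d l) 1)"

lemma lookup_d_v: "Poly_Mapping.lookup (d l) v = of_nat (p l) * b l"
  by (simp add: d_def b_def)

lemma lookup_d:
  "l \<in> L \<Longrightarrow> l' \<in> L \<Longrightarrow> Poly_Mapping.lookup (d l) l' = (if l = l' then of_nat (p l) else 0)"
  by (simp add: d_def diag)

lemma d_neq_0: "l \<in> L \<Longrightarrow> d l \<noteq> 0"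
  using lookup_d[of l l] p_pos[of l] by auto

lemma den_neq_0: "L' \<subseteq> L \<Longrightarrow> den L' \<noteq> 0"
  unfolding den_def using finite_subset[OF _ finite_L]
  by (auto dest: d_neq_0)

lemma den_insert: "finite L' \<Longrightarrow> l \<notin> L' \<Longrightarrow> den (insert l L') = (1 - Poly_Mapping.single (d l) 1) * den L'"
  by (simp add: den_def)

lemma den_remove: "finite L' \<Longrightarrow> l \<in> L' \<Longrightarrow> den L' = (1 - Poly_Mapping.single (d l) 1) * den (L' - {l})"
  by (simp add: den_def prod.remove)

text \<open>The two \<open>v\<close> exponents are commensurable, so an integer combination cancels
  them. It cannot vanish, since its coordinates at \<open>l\<close> and \<open>l'\<close> are
  \<open>s * p l\<close> and \<open>t * p l'\<close>.\<close>

lemma free_relation: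
  assumes "l \<in> L" "l' \<in> L" "l \<noteq> l'"
  obtains s t :: int where
    "scl (of_int s) (d l) + scl (of_int t) (d l') \<noteq> 0"
    "Poly_Mapping.lookup (scl (of_int s) (d l) + scl (of_int t) (d l')) v = 0"
proof -
  obtain s t :: int where st:
    "of_int s * Poly_Mapping.lookup (d l) v + of_int t * Poly_Mapping.lookup (d l') v = 0"
    "s \<noteq> 0 \<or> t \<noteq> 0"
    by (rule rat_linear_relation)
  let ?\<mu> = "scl (of_int s) (d l) + scl (of_int t) (d l')"
  have "Poly_Mapping.lookup ?\<mu> l = of_int s * of_nat (p l)"
       "Poly_Mapping.lookup ?\<mu> l' = of_int t * of_nat (p l')"
    using assms by (simp_all add: lookup_add lookup_d)
  then have "?\<mu> \<noteq> 0"
    using st(2) p_pos[OF assms(1)] p_pos[OF assms(2)] by auto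
  then show ?thesis
    using that st(1) by (simp add: lookup_add)
qed

text \<open>Factors are exchanged one at a time. What the other factors leave of \<open>h\<close>
  has the periods \<open>d l\<close> and \<open>d j\<close>, hence by \<open>free_relation\<close> a
  nonzero period \<open>?\<mu>\<close> free of \<open>v\<close>; the polynomial belonging to
  \<open>?\<mu>\<close> takes the place of factor \<open>l\<close>.\<close>

lemma annihilator_free:
  fixes h :: "(nat \<Rightarrow>\<^sub>0 rat) \<Rightarrow> 'k::field_char_0"
  assumes "finite L'" "L' \<subseteq> L - {j}" "act (den L') h = (\<lambda>_. 0)" "periodic h (d j)"
  obtains E where "E \<noteq> 0" "keys_in v {0} E" "act E h = (\<lambda>_. 0)"
  using assms
proof (induction L' arbitrary: h thesis rule: finite_induct)
  case empty
  then show ?case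
    using empty.prems(1)[of 1] by (simp add: den_def keys_in_one)
next
  case (insert l L')
  let ?h' = "act (den L') h"
  have l: "l \<in> L" "l \<noteq> j" using insert.prems by auto
  obtain s t :: int where st:
    "scl (of_int s) (d l) + scl (of_int t) (d j) \<noteq> 0" (is "?\<mu> \<noteq> 0")
    "Poly_Mapping.lookup (scl (of_int s) (d l) + scl (of_int t) (d j)) v = 0"
    using free_relation[OF l(1) j_in_L l(2)] by blast
  have "act (1 - Poly_Mapping.single (d l) 1) ?h' = (\<lambda>_. 0)"
    using insert by (simp add: den_insert act_mult)
  then have "periodic ?h' (d l)" by (simp add: periodic_iff_act)
  moreover have "periodic ?h' (d j)"
    using insert.prems by (intro periodic_act)
  ultimately have "periodic ?h' ?\<mu>"
    by (intro periodic_add periodic_scl_int)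
  then have *: "act (den L') (act (1 - Poly_Mapping.single ?\<mu> 1) h) = (\<lambda>_. 0)"
    unfolding periodic_iff_act by (subst act_commute)
  obtain E where E: "E \<noteq> 0" "keys_in v {0} E" "act E (act (1 - Poly_Mapping.single ?\<mu> 1) h) = (\<lambda>_. 0)"
    using insert.IH[OF _ _ *] insert.prems by (auto intro: periodic_act)
  show ?case
  proof (rule insert.prems(1))
    show "E * (1 - Poly_Mapping.single ?\<mu> 1) \<noteq> 0"
      using E st by simp
    have "keys_in v {0} (1 + - Poly_Mapping.single ?\<mu> (1::'k))"
      using st by (intro keys_in_add keys_in_uminus keys_in_one keys_in_single) auto
    then show "keys_in v {0} (E * (1 - Poly_Mapping.single ?\<mu> 1))"
      using E by (intro keys_in_mult[of v "{0}" _ "{0}"]) auto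
    show "act (E * (1 - Poly_Mapping.single ?\<mu> 1)) h = (\<lambda>_. 0)"
      using E by (simp add: act_mult)
  qed
qed

section \<open>The Dirac comb and its constant term\<close>

definition comb :: "(nat \<Rightarrow>\<^sub>0 rat) \<Rightarrow> 'k::field_char_0" where
  "comb e = (if \<exists>k::int. e = scl (of_int k) (d j) then 1 else 0)"

lemma d_j_v: "Poly_Mapping.lookup (d j) v \<noteq> 0"
  using pivot p_pos[OF j_in_L] by (simp add: d_def)

lemma periodic_comb: "periodic comb (d j)"
  unfolding periodic_def
proof
  fix x
  have "(\<exists>k::int. x - d j = scl (of_int k) (d j)) \<longleftrightarrow> (\<exists>k::int. x = scl (of_int k) (d j))"
  proof
    assume "\<exists>k::int. x - d j = scl (of_int k) (d j)"
    then obtain k :: int where "x - d j = scl (of_int k) (d j)" by blast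
    then have "x = scl (of_int (k + 1)) (d j)" by (simp add: scl_simps diff_eq_eq)
    then show "\<exists>k::int. x = scl (of_int k) (d j)" by blast
  next
    assume "\<exists>k::int. x = scl (of_int k) (d j)"
    then obtain k :: int where "x = scl (of_int k) (d j)" by blast
    then have "x - d j = scl (of_int (k - 1)) (d j)" by (simp add: scl_simps)
    then show "\<exists>k::int. x - d j = scl (of_int k) (d j)" by blast
  qed
  then show "comb (x - d j) = comb x" by (simp add: comb_def)
qed

text \<open>The pivot is nonzero, so 0 is the only multiple of \<open>d j\<close> free of
  \<open>v\<close>.\<close>

lemma restrict_comb: "restrict_free v comb = (\<lambda>e. 1 when e = 0)"
proof
  fix e
  show "restrict_free v comb e = (1 when e = 0)"
  proof (cases "e = 0")
    case True
    have "\<exists>k::int. 0 = scl (of_int k) (d j)"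
      by (intro exI[of _ 0]) (simp add: scl_simps)
    with True show ?thesis by (simp add: restrict_free_def comb_def)
  next
    case False
    then have "Poly_Mapping.lookup e v \<noteq> 0" if "e = scl (of_int k) (d j)" for k
      using that d_j_v by (auto simp: scl_simps)
    with False show ?thesis by (auto simp: restrict_free_def comb_def)
  qed
qed

text \<open>The \<open>v\<close> exponents of the comb are the integer multiples of that of
  \<open>d j\<close>. A shift strictly between 0 and the step length never brings one of them to 0.
  This is where the degree bound on the numerators will enter.\<close>

lemma restrict_act_comb_zero:
  fixes B :: "(nat \<Rightarrow>\<^sub>0 rat) \<Rightarrow>\<^sub>0 'k::field_char_0"
  assumes "keys_in v {0<..<\<bar>Poly_Mapping.lookup (d j) v\<bar>} B"
  shows "restrict_free v (act B comb) = (\<lambda>_. 0)"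
proof
  fix e
  have "comb (e - a) = (0::'k)" if e: "Poly_Mapping.lookup e v = 0" and a: "a \<in> Poly_Mapping.keys B" for a
  proof (rule ccontr)
    assume "comb (e - a) \<noteq> (0::'k)"
    then obtain k :: int where k: "e - a = scl (of_int k) (d j)"
      by (auto simp: comb_def split: if_splits)
    have "- Poly_Mapping.lookup a v = of_int k * Poly_Mapping.lookup (d j) v"
      using arg_cong[OF k, of "\<lambda>e. Poly_Mapping.lookup e v"] e by (simp add: lookup_minus)
    then have *: "\<bar>Poly_Mapping.lookup a v\<bar> = of_int \<bar>k\<bar> * \<bar>Poly_Mapping.lookup (d j) v\<bar>"
      by (metis abs_minus abs_mult of_int_abs)
    have a': "0 < Poly_Mapping.lookup a v" "Poly_Mapping.lookup a v < \<bar>Poly_Mapping.lookup (d j) v\<bar>"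
      using assms a by (auto simp: keys_in_def)
    then have "k \<noteq> 0" using * by auto
    then have "(1::rat) \<le> of_int \<bar>k\<bar>"
      by (simp only: of_int_1_le_iff)
    then have "1 * \<bar>Poly_Mapping.lookup (d j) v\<bar> \<le> of_int \<bar>k\<bar> * \<bar>Poly_Mapping.lookup (d j) v\<bar>"
      by (rule mult_right_mono) simp
    then show False using * a' by linarith
  qed
  then show "restrict_free v (act B comb) e = 0"
    by (simp add: restrict_free_def act_def)
qed

section \<open>From a decomposition to a represented series\<close>

lemma w_times_x_power:
  fixes m a :: nat
  assumes "of_nat a = \<bar>of_nat m * (of_nat (p l) * b l)\<bar>" "m > 0"
  shows "(if b l < 0 then inverse (u l ^ p l) else u l ^ p l)
           * monom_fun (Poly_Mapping.single v (1 / of_nat m)) ^ a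
         = (if b l < 0 then monom_fun (- d l) else monom_fun (d l) :: 'k::field_char_0 frac_rat_fun)"
proof -
  have 1: "u l ^ p l = (monom_fun (scl (of_nat (p l)) (G l - Poly_Mapping.single v (b l))) :: 'k frac_rat_fun)"
    by (simp add: u_def monom_fun_scl_of_nat)
  have 2: "monom_fun (Poly_Mapping.single v (1 / of_nat m)) ^ a
      = (monom_fun (scl (of_nat a) (Poly_Mapping.single v (1 / of_nat m))) :: 'k frac_rat_fun)"
    by (simp add: monom_fun_scl_of_nat)
  \<comment> \<open>The defining equation of \<open>a\<close> undoes the passage to the
    \<open>m\<close>th root of \<lambda>, so the result no longer involves \<open>m\<close>.\<close>
  have 3: "of_nat a * (1 / of_nat m) = \<bar>of_nat (p l) * b l\<bar>"
    using assms(2) unfolding assms(1) by (simp add: abs_mult)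
  have 4: "\<bar>of_nat (p l) * b l\<bar> = (if b l < 0 then - (of_nat (p l) * b l) else of_nat (p l) * b l)"
    by (simp add: abs_mult)
  have "(if b l < 0 then - scl (of_nat (p l)) (G l - Poly_Mapping.single v (b l))
           else scl (of_nat (p l)) (G l - Poly_Mapping.single v (b l)))
         + scl (of_nat a) (Poly_Mapping.single v (1 / of_nat m)) = (if b l < 0 then - d l else d l)"
    by (rule poly_mapping_eqI)
       (auto simp: lookup_add lookup_minus lookup_single when_def d_def 3 4 algebra_simps
             simp del: of_nat_mult times_divide_eq_right mult_1_right)
  then show ?thesis
    by (auto simp: 1 2 simp flip: monom_fun_uminus monom_fun_add split: if_splits)
qed

text \<open>For \<open>b l < 0\<close> this is the identity (1 - X) / (1 - 1/X) = -X. Its minus sign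
  is the origin of the sign in the theorem.\<close>

lemma den_factor:
  fixes Y :: "'k::field_char_0 frac_rat_fun"
  assumes "l \<in> L" "Y = (if b l < 0 then monom_fun (- d l) else monom_fun (d l))"
  shows "1 - Y \<noteq> 0" "emb (1 - Poly_Mapping.single (d l) 1) / (1 - Y) = (if b l < 0 then - monom_fun (d l) else 1)"
proof -
  have 1: "monom_fun (d l) \<noteq> (1 :: 'k frac_rat_fun)" "monom_fun (- d l) \<noteq> (1 :: 'k frac_rat_fun)"
    using d_neq_0[OF assms(1)] monom_fun_eq_iff[of "d l" 0, where 'k='k]
      monom_fun_eq_iff[of "- d l" 0, where 'k='k] by auto
  then show "1 - Y \<noteq> 0"
    using assms(2) by auto
  have 2: "emb (1 - Poly_Mapping.single (d l) 1) = 1 - (monom_fun (d l) :: 'k frac_rat_fun)"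
    by (simp only: emb_simps monom_fun_def)
  show "emb (1 - Poly_Mapping.single (d l) 1) / (1 - Y) = (if b l < 0 then - monom_fun (d l) else 1)"
    using \<open>1 - Y \<noteq> 0\<close> unfolding 2 assms(2)
    by (auto simp: monom_fun_uminus field_simps)
qed

lemma a_pos_iff:
  assumes "of_nat a = \<bar>of_nat m * (of_nat (p l) * b l)\<bar>" "m > (0::nat)" "l \<in> L"
  shows "a > 0 \<longleftrightarrow> b l \<noteq> 0"
  using assms p_pos[OF assms(3)] by (cases "a = 0") auto

text \<open>\<open>g\<close> stands for the comb times \<open>F\<close> freed from its factor
  \<open>j\<close>; as series cannot be divided, it enters as a solution of an equation. The series
  in the conclusion depends on neither \<open>m\<close> nor \<open>A\<close>, which later yields
  uniqueness of the constant term.\<close>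

lemma partial_fractions_imp_represents:
  fixes F :: "'k::field_char_0 frac_rat_fun"
  assumes F: "emb (den L) * F = emb N"
    and g: "periodic g (d j)" "act (den (L - {j})) g = act N comb"
    and pf: "partial_fractions v L u b p F m A"
  shows "represents (\<lambda>e. (if b j < 0 then - 1 else 1) * restrict_free v g e) (poly (A j) 0)"
proof -
  define x :: "'k frac_rat_fun" where "x = monom_fun (Poly_Mapping.single v (1 / of_nat m))"
  define w :: "nat \<Rightarrow> 'k frac_rat_fun" where "w l = (if b l < 0 then inverse (u l ^ p l) else u l ^ p l)" for l
  define q :: "nat set \<Rightarrow> 'k frac_rat_fun" where "q L' = emb (den L')" for L'
  obtain a P Q t where m: "m > 0"
    and a: "\<And>l. l \<in> L \<Longrightarrow> of_nat (a l) = \<bar>of_nat m * (of_nat (p l) * b l)\<bar>"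
    and free: "\<And>i. free_of v (coeff P i)" "\<And>i. free_of v (coeff Q i)"
      "\<And>l i. l \<in> L \<Longrightarrow> free_of v (coeff (A l) i)"
    and deg: "\<And>l. l \<in> L \<Longrightarrow> a l > 0 \<Longrightarrow> Polynomial.degree (A l) < a l"
    and F_eq: "F = poly P x + poly Q x / x ^ t +
        (\<Sum>l \<in> {l \<in> L. a l > 0}. poly (A l) x / (1 - w l * x ^ a l))"
    using pf unfolding partial_fractions_def Let_def x_def w_def by blast
  have fin: "finite L'" if "L' \<subseteq> L" for L'
    using that finite_L finite_subset by blast
  have Y: "w l * x ^ a l = (if b l < 0 then monom_fun (- d l) else monom_fun (d l))" if "l \<in> L" for l
    unfolding w_def x_def by (rule w_times_x_power[OF a[OF that] m])
  \<comment> \<open>The ratio of factor \<open>l\<close> to the factor used by the decomposition, a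
    unit of the Laurent polynomial ring.\<close>
  define \<rho> :: "nat \<Rightarrow> (nat \<Rightarrow>\<^sub>0 rat) \<Rightarrow>\<^sub>0 'k"
    where "\<rho> l = (if b l < 0 then - Poly_Mapping.single (d l) 1 else 1)" for l
  have q_div: "q L' * (H / (1 - w l * x ^ a l)) = q (L' - {l}) * H * emb (\<rho> l)"
    if "L' \<subseteq> L" "l \<in> L'" for L' l H
  proof -
    have l: "l \<in> L" using that by blast
    have \<rho>_l: "emb (1 - Poly_Mapping.single (d l) 1) / (1 - w l * x ^ a l) = emb (\<rho> l)"
      unfolding den_factor(2)[OF l Y[OF l]]
      by (simp add: \<rho>_def monom_fun_def One_fract_def)
    have q_L': "q L' = emb (1 - Poly_Mapping.single (d l) 1) * q (L' - {l})"
      unfolding q_def den_remove[OF fin[OF that(1)] that(2)] by (simp only: emb_simps)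
    show ?thesis
      unfolding q_L' \<rho>_l[symmetric] by (simp only: divide_inverse mult_ac)
  qed
  have x: "clearable v UNIV x" "clearable v UNIV (inverse x)"
    unfolding x_def by (auto intro: clearable_monom simp flip: monom_fun_uminus)
  have q: "clearable v UNIV (q L')" for L'
    unfolding q_def by (intro clearable_emb) (simp add: keys_in_def)
  have \<rho>: "clearable v UNIV (emb (\<rho> l))" for l
    by (intro clearable_emb) (simp add: keys_in_def)

  have j: "a j > 0" "j \<in> L"
    using a_pos_iff[OF a[OF j_in_L] m j_in_L] pivot j_in_L by (auto simp: b_def)
  define Rest where "Rest = poly P x + poly Q x / x ^ t +
        (\<Sum>l \<in> {l \<in> L. a l > 0} - {j}. poly (A l) x / (1 - w l * x ^ a l))"
  \<comment> \<open>The numerator splits into its value \<open>c\<close> at 0 and a part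
    \<open>T\<close> whose \<open>v\<close> exponents lie strictly between 0 and the step length of
    the comb.\<close>
  define c where "c = coeff (A j) 0"
  define T where "T = (\<Sum>i\<in>{1..<a j}. coeff (A j) i * x ^ i)"
  have F_split: "F = Rest + poly (A j) x / (1 - w j * x ^ a j)"
    unfolding F_eq Rest_def using j finite_L
    by (subst sum.remove[of _ j]) (auto simp: algebra_simps)
  have Aj: "poly (A j) x = c + T"
  proof -
    have "poly (A j) x = (\<Sum>i<a j. coeff (A j) i * x ^ i)"
      unfolding poly_altdef using deg[OF j(2,1)]
      by (intro sum.mono_neutral_left) (auto simp: coeff_eq_0)
    also have "{..<a j} = insert 0 {1..<a j}"
      using j by auto
    finally show ?thesis by (simp add: c_def T_def)
  qed
  have T: "clearable v {0<..<\<bar>Poly_Mapping.lookup (d j) v\<bar>} T"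
    unfolding T_def
  proof (intro clearable_sum)
    fix i assume i: "i \<in> {1..<a j}"
    have x_pow: "x ^ i = monom_fun (scl (of_nat i) (Poly_Mapping.single v (1 / of_nat m)))"
      by (simp add: x_def monom_fun_scl_of_nat)
    have "(of_nat i :: rat) < of_nat (a j)" "(0::rat) < of_nat i" using i by auto
    then have "of_nat i * (1 / of_nat m) \<in> {0<..<\<bar>Poly_Mapping.lookup (d j) v\<bar>}"
      using m a[OF j(2)] by (auto simp: lookup_d_v abs_mult field_simps)
    then have "clearable v {0<..<\<bar>Poly_Mapping.lookup (d j) v\<bar>} (x ^ i)"
      unfolding x_pow by (intro clearable_monom) simp
    then show "clearable v {0<..<\<bar>Poly_Mapping.lookup (d j) v\<bar>} (coeff (A j) i * x ^ i)"
      using free(3)[OF j(2), of i] unfolding free_of_iff_clearable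
      by (elim clearable_mult) auto
  qed
  \<comment> \<open>The poles of \<open>Rest\<close> come from factors other than \<open>j\<close>,
    and negative powers of \<open>x\<close> are Laurent monomials; so the product is polynomial up
    to a denominator free of \<open>v\<close>.\<close>
  have Rest: "clearable v UNIV (q (L - {j}) * Rest)"
  proof -
    have "(\<Sum>l \<in> {l \<in> L. a l > 0} - {j}. q (L - {j}) * (poly (A l) x / (1 - w l * x ^ a l)))
        = (\<Sum>l \<in> {l \<in> L. a l > 0} - {j}. q (L - {j} - {l}) * poly (A l) x * emb (\<rho> l))"
      by (intro sum.cong refl q_div) auto
    then have *: "q (L - {j}) * Rest = q (L - {j}) * poly P x + q (L - {j}) * (poly Q x * inverse x ^ t) +
      (\<Sum>l \<in> {l \<in> L. a l > 0} - {j}. q (L - {j} - {l}) * poly (A l) x * emb (\<rho> l))"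
      unfolding Rest_def distrib_left sum_distrib_left by (simp add: divide_inverse power_inverse)
    show ?thesis unfolding *
      by (intro clearable_add clearable_sum clearable_UNIV_mult clearable_power clearable_UNIV_poly q x \<rho> free)
         auto
  qed
  obtain D1 R where 1: "D1 \<noteq> 0" "keys_in v {0} D1" "emb D1 * (q (L - {j}) * Rest) = emb R"
    using Rest unfolding clearable_def by blast
  obtain D2 c' where 2: "D2 \<noteq> 0" "keys_in v {0} D2" "keys_in v {0} c'" "emb D2 * c = emb c'"
    using free(3)[OF j(2), of 0] unfolding c_def free_of_iff_clearable clearable_def by blast
  obtain D3 B' where 3: "D3 \<noteq> 0" "keys_in v {0} D3"
    "keys_in v {0<..<\<bar>Poly_Mapping.lookup (d j) v\<bar>} B'" "emb D3 * T = emb B'"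
    using T unfolding clearable_def by blast
  define D where "D = D1 * D2 * D3"
  define C where "C = D1 * D3 * c'"
  define B where "B = D1 * D2 * B'"
  have keys_mult_free: "keys_in v K (S * S')" if "keys_in v {0} S" "keys_in v K S'"
    for K and S S' :: "(nat \<Rightarrow>\<^sub>0 rat) \<Rightarrow>\<^sub>0 'k"
    using that by (elim keys_in_mult) auto
  have D: "D \<noteq> 0" "keys_in v {0} D" and C: "keys_in v {0} C"
    and B: "keys_in v {0<..<\<bar>Poly_Mapping.lookup (d j) v\<bar>} B"
    unfolding D_def C_def B_def using 1 2 3 by (auto intro!: keys_mult_free)
  have "emb N = q L * Rest + q L * (poly (A j) x / (1 - w j * x ^ a j))"
    unfolding F[symmetric] F_split by (simp add: q_def distrib_left)
  also have "q L = emb (1 - Poly_Mapping.single (d j) 1) * q (L - {j})"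
    unfolding q_def den_remove[OF finite_L j(2)] by (simp only: emb_simps)
  also have "emb (1 - Poly_Mapping.single (d j) 1) * q (L - {j}) * (poly (A j) x / (1 - w j * x ^ a j))
      = q (L - {j}) * (c + T) * emb (\<rho> j)"
    using q_div[of L j "poly (A j) x"] j den_remove[OF finite_L j(2), where 'a='k] unfolding Aj q_def
    by (simp only: emb_simps)
  finally have N1: "emb N = emb (1 - Poly_Mapping.single (d j) 1) * (q (L - {j}) * Rest)
      + q (L - {j}) * (c + T) * emb (\<rho> j)"
    by (simp only: mult.assoc)
  have "emb (D * N) = emb D * emb N" by (simp only: emb_simps)
  also have "\<dots> = emb (1 - Poly_Mapping.single (d j) 1) * emb (D2 * D3) * (emb D1 * (q (L - {j}) * Rest))
      + q (L - {j}) * (emb (D1 * D3) * (emb D2 * c) + emb (D1 * D2) * (emb D3 * T)) * emb (\<rho> j)"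
    unfolding N1 D_def by (simp only: emb_simps(3) distrib_left distrib_right mult_ac)
  also have "\<dots> = emb ((1 - Poly_Mapping.single (d j) 1) * (D2 * D3) * R + den (L - {j}) * (C + B) * \<rho> j)"
    unfolding 1(3) 2(4) 3(4) unfolding q_def C_def B_def by (simp only: emb_simps)
  \<comment> \<open>The first summand is a multiple of factor \<open>j\<close> and dies on the comb.
    In the second, \<open>C\<close> stems from \<open>c\<close> and \<open>B\<close> from
    \<open>T\<close>.\<close>
  finally have DN: "D * N = (D2 * D3 * R) * (1 - Poly_Mapping.single (d j) 1) + den (L - {j}) * (C + B) * \<rho> j"
    by (simp only: emb_eq_iff mult_ac)
  define \<sigma> :: 'k where "\<sigma> = (if b j < 0 then - 1 else 1)"
  have \<sigma>: "\<sigma> * \<sigma> = 1" by (simp add: \<sigma>_def)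
  have comb0: "act (1 - Poly_Mapping.single (d j) 1) comb = (\<lambda>_. 0 :: 'k)"
    using periodic_comb by (simp add: periodic_iff_act)
  \<comment> \<open>The comb is invariant under translation by \<open>d j\<close>, so of the unit
    \<open>\<rho> j\<close> only its sign survives.\<close>
  have \<rho>_comb: "act (\<rho> j) comb = (\<lambda>e. \<sigma> * comb e)"
    using periodic_comb[where 'a='k] by (auto simp: \<rho>_def \<sigma>_def act_uminus act_single periodic_def)
  have act_DN: "act (den (L - {j})) (act D g) = (\<lambda>e. \<sigma> * act (den (L - {j})) (act (C + B) comb) e)"
  proof -
    have "act (den (L - {j})) (act D g) = act (D * N) comb"
      by (simp only: act_commute[of _ D] g act_mult)
    also have "\<dots> = (\<lambda>e. \<sigma> * act (den (L - {j})) (act (C + B) comb) e)"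
      by (simp only: DN act_add act_mult comb0 \<rho>_comb act_fun_zero act_fun_scale add_0)
    finally show ?thesis .
  qed
  \<comment> \<open>The factors in \<open>L - {j}\<close> cannot be cancelled directly:
    \<open>h\<close> is the resulting torsion, and its period \<open>d j\<close> makes it
    annihilable by some \<open>E\<close> free of \<open>v\<close>.\<close>
  define h where "h = (\<lambda>e. act D g e - \<sigma> * act (C + B) comb e)"
  have h1: "act (den (L - {j})) h = (\<lambda>_. 0)"
    unfolding h_def act_fun_minus act_fun_scale act_DN by simp
  have h2: "periodic h (d j)"
    using periodic_act[OF g(1), of D] periodic_act[OF periodic_comb, of "C + B"]
    by (simp add: h_def periodic_def)
  obtain E where E: "E \<noteq> 0" "keys_in v {0} E" "act E h = (\<lambda>_. 0)"
    using annihilator_free[OF _ _ h1 h2] finite_L by blast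
  have ED: "keys_in v {0} (E * D)" and EC: "keys_in v {0} (E * C)"
    and EB: "keys_in v {0<..<\<bar>Poly_Mapping.lookup (d j) v\<bar>} (E * B)"
    using E D C B by (auto intro!: keys_mult_free)
  have "act (E * D) g = (\<lambda>e. \<sigma> * (act (E * C) comb e + act (E * B) comb e))"
  proof -
    have "act E (act D g) = (\<lambda>e. \<sigma> * act E (act (C + B) comb) e)"
      using E(3) unfolding h_def act_fun_minus act_fun_scale by (simp add: fun_eq_iff)
    then show ?thesis
      by (simp only: act_mult act_add act_fun_add)
  qed
  \<comment> \<open>Only now is the constant term taken: \<open>E * D\<close> and
    \<open>E * C\<close> pass through the projection, the comb becomes the delta series, and
    \<open>E * B\<close> contributes nothing.\<close>
  then have "act (E * D) (restrict_free v g) =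
      restrict_free v (\<lambda>e. \<sigma> * (act (E * C) comb e + act (E * B) comb e))"
    by (simp flip: restrict_free_act[OF ED])
  also have "\<dots> = (\<lambda>e. \<sigma> * (restrict_free v (act (E * C) comb) e + restrict_free v (act (E * B) comb) e))"
    by (simp add: restrict_free_def fun_eq_iff)
  also have "\<dots> = (\<lambda>e. \<sigma> * Poly_Mapping.lookup (E * C) e)"
    by (simp only: restrict_free_act[OF EC] restrict_act_comb_zero[OF EB] restrict_comb
        lookup_eq_act add_0_right)
  finally have "act (E * D) (\<lambda>e. \<sigma> * restrict_free v g e) = Poly_Mapping.lookup (E * C)"
    by (simp add: act_fun_scale \<sigma> flip: mult.assoc)
  then have "represents (\<lambda>e. \<sigma> * restrict_free v g e) (emb (E * C) / emb (E * D))"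
    using E D by (intro represents_emb) auto
  also have "emb (E * C) / emb (E * D) = c"
  proof -
    have "emb (E * C) = emb E * emb (D1 * D3) * (emb D2 * c)"
      unfolding 2 C_def by (simp only: emb_simps mult_ac)
    also have "\<dots> = emb (E * D) * c"
      unfolding D_def by (simp only: emb_simps mult_ac)
    finally show ?thesis using E D by (simp only: emb_eq_0_iff mult_eq_0_iff nonzero_mult_div_cancel_left) simp
  qed
  finally show ?thesis
    by (simp add: c_def \<sigma>_def poly_0_coeff_0)
qed

text \<open>
  Instead of the Bezout identity: the \<open>\<delta>\<close> such that the inverse of the denominator times $1 - y^\delta$ can be
  decomposed form a group. With two factors left it contains a nonzero vector free of \<open>v\<close>, and
  $1 - y^\delta$ is then a scalar that can be divided out.
\<close>

lemma partial_fractions_exist: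
  fixes N :: "(nat \<Rightarrow>\<^sub>0 rat) \<Rightarrow>\<^sub>0 'k::field_char_0"
  obtains m A where "partial_fractions v L u b p (emb N / emb (den L)) m A"
proof -
  \<comment> \<open>One \<open>m\<close> makes the \<open>v\<close> exponents of the numerator and
    of all factors integral. The exponents with this property form the group \<open>U\<close>, which
    all later shifts respect.\<close>
  obtain m :: nat where m: "m > 0" and m_int:
    "\<And>s. s \<in> (\<lambda>e. Poly_Mapping.lookup e v) ` (Poly_Mapping.keys N \<union> d ` L) \<Longrightarrow> of_nat m * s \<in> \<int>"
    by (rule common_denominator[of "(\<lambda>e. Poly_Mapping.lookup e v) ` (Poly_Mapping.keys N \<union> d ` L)"])
       (use finite_L in auto)
  define U :: "(nat \<Rightarrow>\<^sub>0 rat) set" where "U = {e. of_nat m * Poly_Mapping.lookup e v \<in> \<int>}"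
  have U: "0 \<in> U" "\<And>e e'. e \<in> U \<Longrightarrow> e' \<in> U \<Longrightarrow> e + e' \<in> U" "\<And>e. e \<in> U \<Longrightarrow> - e \<in> U"
    and dU: "\<And>l. l \<in> L \<Longrightarrow> d l \<in> U" and NU: "\<And>e. e \<in> Poly_Mapping.keys N \<Longrightarrow> e \<in> U"
    using m_int by (auto simp: U_def lookup_add distrib_left)
  define x :: "'k frac_rat_fun" where "x = monom_fun (Poly_Mapping.single v (1 / of_nat m))"
  define w :: "nat \<Rightarrow> 'k frac_rat_fun" where "w l = (if b l < 0 then inverse (u l ^ p l) else u l ^ p l)" for l
  define a where "a l = nat \<bar>\<lfloor>of_nat m * (of_nat (p l) * b l)\<rfloor>\<bar>" for l
  have a: "of_nat (a l) = \<bar>of_nat m * (of_nat (p l) * b l)\<bar>" if "l \<in> L" for l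
  proof -
    have "of_nat m * (of_nat (p l) * b l) \<in> \<int>"
      using dU[OF that] by (simp add: U_def lookup_d_v)
    then obtain k where "of_nat m * (of_nat (p l) * b l) = of_int k"
      by (elim Ints_cases)
    then show ?thesis by (simp add: a_def)
  qed
  have Y: "w l * x ^ a l = (if b l < 0 then monom_fun (- d l) else monom_fun (d l))" if "l \<in> L" for l
    unfolding w_def x_def by (rule w_times_x_power[OF a[OF that] m])

  \<comment> \<open>With \<open>m\<close> and \<open>a\<close> fixed, decomposability is preserved
    by sums and by multiples free of \<open>v\<close>; so monomial numerators suffice.\<close>
  define pf where "pf F \<longleftrightarrow> (\<exists>P Q t A.
      (\<forall>i. free_of v (coeff P i)) \<and> (\<forall>i. free_of v (coeff Q i)) \<and>
      (\<forall>l \<in> L. \<forall>i. free_of v (coeff (A l) i)) \<and>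
      (Q = 0 \<or> Polynomial.degree Q < t) \<and>
      (\<forall>l \<in> L. a l > 0 \<longrightarrow> Polynomial.degree (A l) < a l) \<and>
      F = poly P x + poly Q x / x ^ t +
         (\<Sum>l \<in> {l \<in> L. a l > 0}. poly (A l) x / (1 - w l * x ^ a l)))" for F :: "'k frac_rat_fun"
  have pf_imp: "\<exists>A. partial_fractions v L u b p F m A" if pf_F: "pf F" for F
    using pf_F[unfolded pf_def] m a unfolding partial_fractions_def Let_def x_def w_def by blast
  have x0: "x \<noteq> 0" by (simp add: x_def)
  have pf_scale: "pf (c * F)" if c: "free_of v c" and F: "pf F" for c F
  proof -
    obtain P Q t A where *: "\<And>i. free_of v (coeff P i)" "\<And>i. free_of v (coeff Q i)"
      "\<And>l i. l \<in> L \<Longrightarrow> free_of v (coeff (A l) i)"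
      "Q = 0 \<or> Polynomial.degree Q < t" "\<And>l. l \<in> L \<Longrightarrow> a l > 0 \<Longrightarrow> Polynomial.degree (A l) < a l"
      "F = poly P x + poly Q x / x ^ t + (\<Sum>l \<in> {l \<in> L. a l > 0}. poly (A l) x / (1 - w l * x ^ a l))"
      using F unfolding pf_def by blast
    show ?thesis
      unfolding pf_def
    proof (intro exI conjI)
      show "smult c Q = 0 \<or> Polynomial.degree (smult c Q) < t"
        using *(4) by auto
      show "\<forall>l \<in> L. a l > 0 \<longrightarrow> Polynomial.degree (smult c (A l)) < a l"
        using *(5) by auto
      show "c * F = poly (smult c P) x + poly (smult c Q) x / x ^ t +
          (\<Sum>l \<in> {l \<in> L. a l > 0}. poly (smult c (A l)) x / (1 - w l * x ^ a l))"
        unfolding *(6) by (simp add: distrib_left sum_distrib_left)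
    qed (auto intro!: free_of_mult c * simp: coeff_smult)
  qed
  have pf_add: "pf (F + F')" if F: "pf F" and F': "pf F'" for F F'
  proof -
    obtain P Q t A where *: "\<And>i. free_of v (coeff P i)" "\<And>i. free_of v (coeff Q i)"
      "\<And>l i. l \<in> L \<Longrightarrow> free_of v (coeff (A l) i)"
      "Q = 0 \<or> Polynomial.degree Q < t" "\<And>l. l \<in> L \<Longrightarrow> a l > 0 \<Longrightarrow> Polynomial.degree (A l) < a l"
      "F = poly P x + poly Q x / x ^ t + (\<Sum>l \<in> {l \<in> L. a l > 0}. poly (A l) x / (1 - w l * x ^ a l))"
      using F unfolding pf_def by blast
    obtain P' Q' t' A' where **: "\<And>i. free_of v (coeff P' i)" "\<And>i. free_of v (coeff Q' i)"
      "\<And>l i. l \<in> L \<Longrightarrow> free_of v (coeff (A' l) i)"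
      "Q' = 0 \<or> Polynomial.degree Q' < t'" "\<And>l. l \<in> L \<Longrightarrow> a l > 0 \<Longrightarrow> Polynomial.degree (A' l) < a l"
      "F' = poly P' x + poly Q' x / x ^ t' + (\<Sum>l \<in> {l \<in> L. a l > 0}. poly (A' l) x / (1 - w l * x ^ a l))"
      using F' unfolding pf_def by blast
    \<comment> \<open>The two polar parts at 0 are brought over the common denominator
      \<open>x ^ (t + t')\<close>.\<close>
    let ?Q = "monom 1 t' * Q + monom 1 t * Q'"
    show ?thesis
      unfolding pf_def
    proof (intro exI conjI)
      have "coeff ?Q i = 0" if "i \<ge> t + t'" for i
        using that *(4) **(4) by (auto simp: coeff_monom_mult coeff_eq_0)
      then show "?Q = 0 \<or> Polynomial.degree ?Q < t + t'"
        by (metis leading_coeff_0_iff not_le)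
      show "\<forall>l \<in> L. a l > 0 \<longrightarrow> Polynomial.degree (A l + A' l) < a l"
        using *(5) **(5) by (auto intro: degree_add_less)
      show "F + F' = poly (P + P') x + poly ?Q x / x ^ (t + t') +
          (\<Sum>l \<in> {l \<in> L. a l > 0}. poly (A l + A' l) x / (1 - w l * x ^ a l))"
        unfolding *(6) **(6) using x0
        by (simp add: poly_monom sum.distrib add_divide_distrib power_add)
    qed (use * ** in \<open>auto intro!: free_of_add simp: coeff_monom_mult\<close>)
  qed
  have pf_0: "pf 0"
    unfolding pf_def by (intro exI[of _ 0] exI[of _ 0] exI[of _ "\<lambda>_. 0"]) auto
  have pf_minus: "pf (F - F')" if "pf F" "pf F'" for F F'
  proof -
    have "free_of v (- 1 :: 'k frac_rat_fun)"
      using clearable_uminus[of v "{0}" "1 :: 'k frac_rat_fun"] free_of_monom[of 0 v, where 'a='k]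
      by (simp add: free_of_iff_clearable)
    then show ?thesis
      using pf_add[OF that(1) pf_scale[OF _ that(2), of "- 1"]] by simp
  qed
  have pf_sum: "pf (\<Sum>i\<in>I. F i)" if "\<And>i. i \<in> I \<Longrightarrow> pf (F i)" for I :: "(nat \<Rightarrow>\<^sub>0 rat) set" and F
    using that by (induction I rule: infinite_finite_induct) (auto intro: pf_0 pf_add)

  define xk where "xk k = (monom_fun (Poly_Mapping.single v (of_int k / of_nat m)) :: 'k frac_rat_fun)" for k :: int
  have xk_add: "xk (k + l) = xk k * xk l" for k l
    by (simp add: xk_def single_add add_divide_distrib flip: monom_fun_add)
  have xk_of_nat: "xk (int i) = x ^ i" for i
  proof -
    have "scl (of_nat i) (Poly_Mapping.single v (1 / of_nat m)) = Poly_Mapping.single v (of_nat i / of_nat m)"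
      by (rule poly_mapping_eqI) (simp add: lookup_single when_def)
    then show ?thesis
      by (simp add: xk_def x_def flip: monom_fun_scl_of_nat)
  qed
  have free_1: "free_of v (1 :: 'k frac_rat_fun)"
    using free_of_monom[of 0 v, where 'a='k] by simp
  have free_monom: "free_of v (coeff (monom 1 i) i' :: 'k frac_rat_fun)" for i i'
    using free_1 by (simp add: coeff_monom)
  have pf_xk: "pf (xk k)" for k
  proof (cases "k \<ge> 0")
    case True
    then obtain i where i: "k = int i" using nonneg_int_cases by blast
    show ?thesis
      unfolding pf_def i xk_of_nat
      by (intro exI[of _ "monom 1 i"] exI[of _ 0] exI[of _ "\<lambda>_. 0"] conjI allI free_monom)
         (auto simp: poly_monom)
  next
    case False
    define i where "i = nat (- k)"
    have i: "k = - int i" "i > 0" using False by (auto simp: i_def)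
    have "xk k * xk (int i) = xk 0" by (simp add: i flip: xk_add)
    also have "xk 0 = 1" by (simp add: xk_def)
    finally have "xk k * xk (int i) = 1" .
    then have xk: "xk k = 1 / x ^ i"
      using x0 by (simp add: xk_of_nat field_simps)
    show ?thesis
      unfolding pf_def xk using i
      by (intro exI[of _ 0] exI[of _ "monom 1 0"] exI[of _ i] exI[of _ "\<lambda>_. 0"] conjI allI free_monom)
         (auto simp: poly_monom degree_monom_eq)
  qed
  have pf_frac: "pf (xk k / (1 - w l * x ^ a l))" if l: "l \<in> L" "a l > 0" for k l
  proof -
    let ?Y = "w l * x ^ a l"
    have free_w: "free_of v (w l)" "free_of v (inverse (w l))" "w l \<noteq> 0"
    proof -
      have "u l ^ p l = (monom_fun (scl (of_nat (p l)) (G l - Poly_Mapping.single v (b l))) :: 'k frac_rat_fun)"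
        by (simp add: u_def monom_fun_scl_of_nat)
      then have "\<exists>\<mu>. Poly_Mapping.lookup \<mu> v = 0 \<and> w l = monom_fun \<mu>"
        unfolding w_def
        by (cases "b l < 0") (auto simp: lookup_minus b_def simp flip: monom_fun_uminus
            intro!: exI[of _ "- scl (of_nat (p l)) (G l - Poly_Mapping.single v (b l))"]
            exI[of _ "scl (of_nat (p l)) (G l - Poly_Mapping.single v (b l))"])
      then show "free_of v (w l)" "free_of v (inverse (w l))" "w l \<noteq> 0"
        by (auto simp: free_of_monom simp flip: monom_fun_uminus)
    qed
    have Y1: "1 - ?Y \<noteq> 0" using den_factor(1)[OF l(1) Y[OF l(1)]] .
    have base: "pf (x ^ i / (1 - ?Y))" if "i < a l" for i
    proof -
      have "(\<Sum>l' \<in> {l \<in> L. a l > 0}. poly (if l' = l then monom 1 i else 0) x / (1 - w l' * x ^ a l'))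
          = (\<Sum>l' \<in> {l \<in> L. a l > 0}. if l' = l then x ^ i / (1 - ?Y) else 0)"
        by (intro sum.cong) (auto simp: poly_monom)
      also have "\<dots> = x ^ i / (1 - ?Y)"
        using l finite_L by simp
      finally show ?thesis
        unfolding pf_def using that
        by (intro exI[of _ 0] exI[of _ "\<lambda>l'. if l' = l then monom 1 i else 0"] conjI ballI allI)
           (auto simp: degree_monom_eq free_1)
    qed
    \<comment> \<open>Since \<open>?Y\<close> = 1 - (1 - \<open>?Y\<close>), a shift by
      \<open>a l\<close> costs only a monomial. Every integer exponent thus reduces to its residue
      modulo \<open>a l\<close>, which meets the degree bound.\<close>
    have step: "xk (k + int (a l)) / (1 - ?Y) = inverse (w l) * (xk k / (1 - ?Y) - xk k)" for k
      using Y1 free_w(3) unfolding xk_add xk_of_nat by (simp add: field_simps)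
    have up: "pf (xk (k + int (a l)) / (1 - ?Y))" if "pf (xk k / (1 - ?Y))" for k
      unfolding step by (intro pf_scale pf_minus free_w pf_xk that)
    have down: "pf (xk k / (1 - ?Y))" if "pf (xk (k + int (a l)) / (1 - ?Y))" for k
    proof -
      have "xk k / (1 - ?Y) = w l * (xk (k + int (a l)) / (1 - ?Y)) + xk k"
        unfolding step using free_w(3) by (simp flip: mult.assoc)
      then show ?thesis using pf_add[OF pf_scale[OF free_w(1) that] pf_xk[of k]] by simp
    qed
    have "pf (xk (k mod int (a l) + n * int (a l)) / (1 - ?Y))" for n
    proof (induction n rule: int_induct[where k = 0])
      case base
      have "k mod int (a l) = int (nat (k mod int (a l)))" "nat (k mod int (a l)) < a l"
        using l(2) by (auto simp: nat_less_iff)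
      then show ?case using \<open>\<And>i. i < a l \<Longrightarrow> pf (x ^ i / (1 - ?Y))\<close> xk_of_nat
        by (metis add.right_neutral mult_zero_left)
    next
      case (step1 i)
      then show ?case using up[OF step1(2)] by (simp add: algebra_simps)
    next
      case (step2 i)
      then show ?case using down[of "k mod int (a l) + (i - 1) * int (a l)"] by (simp add: algebra_simps)
    qed
    from this[of "k div int (a l)"] show ?thesis by (simp add: add.commute)
  qed
  have monom_split: "\<exists>c k. free_of v c \<and> monom_fun e = c * xk k" if "e \<in> U" for e
  proof -
    obtain k where k: "of_nat m * Poly_Mapping.lookup e v = of_int k"
      using \<open>e \<in> U\<close> unfolding U_def by (auto elim: Ints_cases)
    then have k': "Poly_Mapping.lookup e v = of_int k / of_nat m" using m by (simp add: field_simps)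
    have "monom_fun e = monom_fun (e - Poly_Mapping.single v (of_int k / of_nat m)) * xk k"
      unfolding xk_def by (simp flip: monom_fun_add)
    then show ?thesis
      using k' free_of_monom[of "e - Poly_Mapping.single v (of_int k / of_nat m)" v] by (auto simp: lookup_minus)
  qed
  have pf_monom: "pf (monom_fun e)" if "e \<in> U" for e
    using monom_split[OF that] pf_scale pf_xk by metis
  have flip_factor: "y / (1 - z) = 0 - (y * inverse z) / (1 - inverse z)" if "z \<noteq> 0"
    for y z :: "'k frac_rat_fun"
  proof -
    have "1 - inverse z = (z - 1) / z" using that by (simp add: field_simps)
    then have "(y * inverse z) / (1 - inverse z) = y / (z - 1)"
      using that by (simp add: divide_inverse)
    also have "\<dots> = - (y / (1 - z))"
      using minus_divide_right[of y "1 - z"] by simp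
    finally show ?thesis by simp
  qed
  have pf_monom_frac: "pf (monom_fun e / (1 - monom_fun (d l)))" if e: "e \<in> U" and l: "l \<in> L" "b l \<noteq> 0" for e l
  proof -
    have a0: "a l > 0" using a_pos_iff[OF a[OF l(1)] m l(1)] l(2) by simp
    let ?Y = "w l * x ^ a l"
    have Y1: "1 - ?Y \<noteq> 0" using den_factor(1)[OF l(1) Y[OF l(1)]] .
    have *: "pf (monom_fun e / (1 - ?Y))" if "e \<in> U" for e
      using monom_split[OF that] pf_scale[OF _ pf_frac[OF l(1) a0]] by (metis times_divide_eq_right)
    show ?thesis
    proof (cases "b l < 0")
      case True
      \<comment> \<open>For a negative exponent the decomposition uses the inverse monomial; the
        flip moves \<open>- d l\<close> into the numerator, which stays in \<open>U\<close>.\<close>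
      have "?Y = inverse (monom_fun (d l))" using Y[OF l(1)] True by (simp add: monom_fun_uminus)
      then have "monom_fun e / (1 - monom_fun (d l)) = 0 - monom_fun (e + - d l) / (1 - ?Y)"
        unfolding monom_fun_add monom_fun_uminus by (simp only: flip_factor[OF monom_fun_neq_0])
      then show ?thesis
        using pf_minus[OF pf_0 *[OF U(2)[OF e U(3)[OF dU[OF l(1)]]]]] by (simp only:)
    next
      case False
      then show ?thesis using *[OF e] Y[OF l(1)] by simp
    qed
  qed
  have free_inv: "free_of v (inverse (1 - monom_fun \<mu>) :: 'k frac_rat_fun)" if "\<mu> \<noteq> 0" "Poly_Mapping.lookup \<mu> v = 0" for \<mu>
  proof -
    have "keys_in v {0} (1 + - Poly_Mapping.single \<mu> (1::'k))"
      using that by (intro keys_in_add keys_in_uminus keys_in_one keys_in_single) auto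
    then have "clearable v {0} (inverse (emb (1 - Poly_Mapping.single \<mu> (1::'k))))"
      using that by (intro clearable_inverse_emb) auto
    then show ?thesis by (simp only: free_of_iff_clearable monom_fun_def emb_simps)
  qed
  have one_minus_neq_0: "1 - monom_fun \<mu> \<noteq> (0 :: 'k frac_rat_fun)" if "\<mu> \<noteq> 0" for \<mu>
    using that monom_fun_eq_iff[of \<mu> 0, where 'k='k] by auto
  have main: "pf (monom_fun e * inverse (\<Prod>l\<in>L'. 1 - monom_fun (d l)))" if "L' \<subseteq> L" "e \<in> U" for L' e
  proof -
    have "finite L'" using that(1) finite_L finite_subset by blast
    then show ?thesis using that
    proof (induction "card L'" arbitrary: L' e rule: less_induct)
      case less
      define H where "H = inverse (\<Prod>l\<in>L'. 1 - monom_fun (d l) :: 'k frac_rat_fun)"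
      \<comment> \<open>All numerators in \<open>U\<close> are quantified over because
        \<open>good_add\<close> and \<open>good_uminus\<close> shift the numerator.\<close>
      define good where "good \<delta> \<longleftrightarrow> \<delta> \<in> U \<and> (\<forall>e\<in>U. pf (monom_fun e * (1 - monom_fun \<delta>) * H))" for \<delta>
      have good_d: "good (d l)" if l: "l \<in> L'" for l
        unfolding good_def
      proof (intro conjI ballI)
        have lL: "l \<in> L" using l less.prems by auto
        then show "d l \<in> U" by (rule dU)
        fix e assume e: "e \<in> U"
        have "(1 - monom_fun (d l)) * H = inverse (\<Prod>l\<in>L'-{l}. 1 - monom_fun (d l))"
          unfolding H_def using less.prems l one_minus_neq_0[OF d_neq_0[OF lL]]
          by (simp add: prod.remove[of L' l])
        moreover have "pf (monom_fun e * inverse (\<Prod>l\<in>L'-{l}. 1 - monom_fun (d l)))"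
          using less.prems l e by (intro less.hyps card_Diff1_less) auto
        ultimately show "pf (monom_fun e * (1 - monom_fun (d l)) * H)"
          by (simp add: mult.assoc)
      qed
      have good_add: "good (\<delta> + \<delta>')" if "good \<delta>" "good \<delta>'" for \<delta> \<delta>'
        unfolding good_def
      proof (intro conjI ballI)
        show "\<delta> + \<delta>' \<in> U" using that U(2) by (auto simp: good_def)
        fix e assume e: "e \<in> U"
        \<comment> \<open>Telescoping: 1 - ab = (1 - a) + a (1 - b).\<close>
        have "monom_fun e * (1 - monom_fun (\<delta> + \<delta>')) * H =
            monom_fun e * (1 - monom_fun \<delta>) * H + monom_fun (e + \<delta>) * (1 - monom_fun \<delta>') * H"
          by (simp add: monom_fun_add algebra_simps)
        then show "pf (monom_fun e * (1 - monom_fun (\<delta> + \<delta>')) * H)"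
          using that e U(2)[of e \<delta>] by (auto simp: good_def intro!: pf_add)
      qed
      have good_0: "good 0"
        using U(1) by (simp add: good_def pf_0)
      have good_uminus: "good (- \<delta>)" if "good \<delta>" for \<delta>
        unfolding good_def
      proof (intro conjI ballI)
        show "- \<delta> \<in> U" using that U(3) by (auto simp: good_def)
        fix e assume e: "e \<in> U"
        have "monom_fun e * (1 - monom_fun (- \<delta>)) * H = 0 - monom_fun (e + - \<delta>) * (1 - monom_fun \<delta>) * H"
          unfolding monom_fun_add monom_fun_uminus by (simp add: field_simps)
        moreover have "pf (monom_fun (e + - \<delta>) * (1 - monom_fun \<delta>) * H)"
          using that e U(2)[of e "- \<delta>"] U(3)[of \<delta>] by (simp add: good_def)
        ultimately show "pf (monom_fun e * (1 - monom_fun (- \<delta>)) * H)"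
          using pf_minus[OF pf_0] by (simp del: diff_0)
      qed
      have good_scl: "good (scl (of_int k) \<delta>)" if "good \<delta>" for k \<delta>
        by (rule int_multiple_closed[where S = good]) (auto intro: that good_0 good_add good_uminus)
      have conclude: ?case if "good \<mu>" "\<mu> \<noteq> 0" "Poly_Mapping.lookup \<mu> v = 0" for \<mu>
      proof -
        have eq: "monom_fun e * H = inverse (1 - monom_fun \<mu>) * (monom_fun e * (1 - monom_fun \<mu>) * H)"
          using one_minus_neq_0[OF that(2)] by (simp add: field_simps)
        have "pf (monom_fun e * (1 - monom_fun \<mu>) * H)"
          using that(1) less.prems by (simp add: good_def)
        from pf_scale[OF free_inv[OF that(2,3)] this] have "pf (monom_fun e * H)"
          unfolding eq .
        then show ?thesis unfolding H_def .
      qed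
      \<comment> \<open>A factor with \<open>b l = 0\<close> supplies a vector free of
        \<open>v\<close> by itself, and two distinct factors supply one through
        \<open>free_relation\<close>. Otherwise at most one factor remains, with nonzero
        \<open>b l\<close>.\<close>
      show ?case
      proof (cases "\<exists>l\<in>L'. b l = 0")
        case True
        then obtain l where l: "l \<in> L'" "b l = 0" by blast
        then show ?thesis
          using conclude[OF good_d[OF l(1)]] d_neq_0[of l] less.prems by (auto simp: lookup_d_v)
      next
        case no_free: False
        show ?thesis
        proof (cases "\<exists>l\<in>L'. \<exists>l'\<in>L'. l \<noteq> l'")
          case True
          then obtain l l' where l: "l \<in> L'" "l' \<in> L'" "l \<noteq> l'" by blast
          then obtain s t :: int where
            "scl (of_int s) (d l) + scl (of_int t) (d l') \<noteq> 0"
            "Poly_Mapping.lookup (scl (of_int s) (d l) + scl (of_int t) (d l')) v = 0"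
            using free_relation[of l l'] less.prems by blast
          then show ?thesis
            by (intro conclude[of "scl (of_int s) (d l) + scl (of_int t) (d l')"] good_add good_scl good_d l)
        next
          case False
          then have "L' = {} \<or> (\<exists>l. L' = {l})" by blast
          then show ?thesis
            using pf_monom less.prems no_free pf_monom_frac by (auto simp: divide_inverse)
        qed
      qed
    qed
  qed
  have "emb N / emb (den L) =
      (\<Sum>e\<in>Poly_Mapping.keys N. emb (Poly_Mapping.single 0 (Poly_Mapping.lookup N e)) *
          (monom_fun e * inverse (\<Prod>l\<in>L. 1 - monom_fun (d l))))"
  proof -
    have "emb N = (\<Sum>e\<in>Poly_Mapping.keys N. emb (Poly_Mapping.single e (Poly_Mapping.lookup N e)))"
      by (simp only: sum_single_keys flip: emb_sum)
    also have "\<dots> = (\<Sum>e\<in>Poly_Mapping.keys N. emb (Poly_Mapping.single 0 (Poly_Mapping.lookup N e)) * monom_fun e)"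
      by (simp add: monom_fun_def mult_single)
    finally have N: "emb N = \<dots>" .
    have "emb (den L) = (\<Prod>l\<in>L. 1 - (monom_fun (d l) :: 'k frac_rat_fun))"
      unfolding den_def emb_prod by (simp only: emb_simps monom_fun_def)
    then show ?thesis
      unfolding N divide_inverse sum_distrib_right by (simp only: mult.assoc)
  qed
  also have "pf \<dots>"
    by (intro pf_sum pf_scale main NU)
       (auto simp: free_of_iff_clearable intro!: clearable_emb keys_in_single)
  finally show ?thesis using pf_imp that by blast
qed

text \<open>The definite description in \<open>CT\<close> is justified without comparing
  decompositions: each of them yields a value represented by the same series, and a series
  represents at most one function.\<close>

lemma CT_represents:
  fixes F :: "'k::field_char_0 frac_rat_fun"
  assumes F: "F = emb N / emb (den L)"
    and g: "periodic g (d j)" "act (den (L - {j})) g = act N comb"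
  shows "represents (\<lambda>e. (if b j < 0 then - 1 else 1) * restrict_free v g e) (CT v j L u b p F)"
proof -
  obtain m A where pf: "partial_fractions v L u b p F m A"
    unfolding F by (rule partial_fractions_exist)
  have F': "emb (den L) * F = emb N"
    unfolding F using den_neq_0[of L, where 'a='k] by (simp only: emb_eq_0_iff order_refl nonzero_mult_div_cancel_left times_divide_eq_right not_False_eq_True)
  have "CT v j L u b p F = poly (A j) 0"
    unfolding CT_def
  proof (rule the_equality)
    show "\<exists>m' A'. partial_fractions v L u b p F m' A' \<and> poly (A j) 0 = poly (A' j) 0"
      using pf by blast
    fix c assume "\<exists>m' A'. partial_fractions v L u b p F m' A' \<and> c = poly (A' j) 0"
    then obtain m' A' where "partial_fractions v L u b p F m' A'" "c = poly (A' j) 0" by blast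
    then show "c = poly (A j) 0"
      using represents_unique partial_fractions_imp_represents[OF F' g] pf by blast
  qed
  then show ?thesis
    using partial_fractions_imp_represents[OF F' g pf] by simp
qed

end

section \<open>Lattice points of shifted cones\<close>

definition series :: "'a set \<Rightarrow> 'a \<Rightarrow> 'k::field_char_0" where
  "series S e = (if e \<in> S then 1 else 0)"

text \<open>No existential quantifier over coefficients occurs: generator \<open>l\<close> has
  coordinate 1 at \<open>l\<close>, while the other generators and the apex have 0 there, so the
  coefficient is the coordinate of the point. Integrality is imposed on the \<open>y\<close>
  exponents only.\<close>

definition affine_points ::
  "nat \<Rightarrow> nat set \<Rightarrow> (nat \<Rightarrow> (nat \<Rightarrow>\<^sub>0 rat)) \<Rightarrow> (nat \<Rightarrow>\<^sub>0 rat) \<Rightarrow> (nat \<Rightarrow>\<^sub>0 rat) set" where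
  "affine_points n L G g0 =
     {V. (\<forall>s<n. Poly_Mapping.lookup V s \<in> \<int>) \<and> V = g0 + (\<Sum>l\<in>L. scl (Poly_Mapping.lookup V l) (G l))}"

definition cone_points ::
  "nat \<Rightarrow> nat set \<Rightarrow> (nat \<Rightarrow> (nat \<Rightarrow>\<^sub>0 rat)) \<Rightarrow> (nat \<Rightarrow>\<^sub>0 rat) \<Rightarrow> nat set \<Rightarrow> (nat \<Rightarrow>\<^sub>0 rat) set" where
  "cone_points n L G g0 L' = {V \<in> affine_points n L G g0. \<forall>l\<in>L'. 0 \<le> Poly_Mapping.lookup V l}"

text \<open>For \<open>L' = B = L\<close> these are the lattice points of the half-open fundamental
  parallelepiped spanned by the vectors \<open>scl (of_nat (p l)) (G l)\<close>. \<open>L'\<close>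
  and \<open>B\<close> list the directions bounded below and above.\<close>

definition box_points ::
  "nat \<Rightarrow> nat set \<Rightarrow> (nat \<Rightarrow> (nat \<Rightarrow>\<^sub>0 rat)) \<Rightarrow> (nat \<Rightarrow>\<^sub>0 rat) \<Rightarrow> (nat \<Rightarrow> nat) \<Rightarrow> nat set \<Rightarrow> nat set
    \<Rightarrow> (nat \<Rightarrow>\<^sub>0 rat) set" where
  "box_points n L G g0 p L' B =
     {V \<in> cone_points n L G g0 L'. \<forall>l\<in>B. Poly_Mapping.lookup V l < of_nat (p l)}"

locale lattice_cone =
  fixes n :: nat and L :: "nat set" and G :: "nat \<Rightarrow> (nat \<Rightarrow>\<^sub>0 rat)" and g0 :: "nat \<Rightarrow>\<^sub>0 rat"
    and p :: "nat \<Rightarrow> nat"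
  assumes finite_gens: "finite L" and L_less: "L \<subseteq> {..<n}"
    and p_gt_0: "l \<in> L \<Longrightarrow> p l > 0"
    and unit_coord: "l \<in> L \<Longrightarrow> l' \<in> L \<Longrightarrow> Poly_Mapping.lookup (G l) l' = (if l = l' then 1 else 0)"
    and integral: "l \<in> L \<Longrightarrow> s < n \<Longrightarrow> of_nat (p l) * Poly_Mapping.lookup (G l) s \<in> \<int>"
begin

definition X :: "nat set \<Rightarrow> (nat \<Rightarrow>\<^sub>0 rat) \<Rightarrow>\<^sub>0 'k::field_char_0" where
  "X L' = (\<Prod>l\<in>L'. 1 - Poly_Mapping.single (scl (of_nat (p l)) (G l)) 1)"

lemma affine_minus_step:
  assumes "l \<in> L" "V \<in> affine_points n L G g0"
  shows "V - scl (of_nat (p l)) (G l) \<in> affine_points n L G g0"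
proof -
  let ?d = "scl (of_nat (p l)) (G l)"
  have "(\<Sum>l'\<in>L. scl (Poly_Mapping.lookup (V - ?d) l') (G l')) =
      (\<Sum>l'\<in>L. scl (Poly_Mapping.lookup V l') (G l')) - (\<Sum>l'\<in>L. scl (Poly_Mapping.lookup ?d l') (G l'))"
    by (simp add: lookup_minus scl_simps sum_subtractf)
  also have "(\<Sum>l'\<in>L. scl (Poly_Mapping.lookup ?d l') (G l')) = (\<Sum>l'\<in>L. if l' = l then ?d else 0)"
    using assms(1) by (intro sum.cong) (auto simp: unit_coord scl_simps)
  also have "\<dots> = ?d" using assms(1) finite_gens by simp
  finally show ?thesis
    using assms integral by (auto simp: affine_points_def lookup_minus)
qed

lemma affine_plus_step:
  assumes "l \<in> L" "V \<in> affine_points n L G g0"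
  shows "V + scl (of_nat (p l)) (G l) \<in> affine_points n L G g0"
proof -
  let ?d = "scl (of_nat (p l)) (G l)"
  have "(\<Sum>l'\<in>L. scl (Poly_Mapping.lookup (V + ?d) l') (G l')) =
      (\<Sum>l'\<in>L. scl (Poly_Mapping.lookup V l') (G l')) + (\<Sum>l'\<in>L. scl (Poly_Mapping.lookup ?d l') (G l'))"
    by (simp add: lookup_add scl_simps sum.distrib)
  also have "(\<Sum>l'\<in>L. scl (Poly_Mapping.lookup ?d l') (G l')) = (\<Sum>l'\<in>L. if l' = l then ?d else 0)"
    using assms(1) by (intro sum.cong) (auto simp: unit_coord scl_simps)
  also have "\<dots> = ?d" using assms(1) finite_gens by simp
  finally show ?thesis
    using assms integral by (auto simp: affine_points_def lookup_add add.assoc)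
qed

lemma affine_periodic:
  assumes "l \<in> L"
  shows "periodic (\<lambda>V. V \<in> affine_points n L G g0) (scl (of_nat (p l)) (G l))"
  unfolding periodic_def
  using affine_minus_step[OF assms] affine_plus_step[OF assms] by (metis diff_add_cancel)

lemma affine_minus_iff:
  "l \<in> L \<Longrightarrow> V - scl (of_nat (p l)) (G l) \<in> affine_points n L G g0 \<longleftrightarrow> V \<in> affine_points n L G g0"
  using affine_periodic unfolding periodic_def by blast

text \<open>The translate in direction \<open>l\<close> is the part with coordinate \<open>l\<close>
  at least \<open>p l\<close>; removing it leaves a slab.\<close>

lemma act_step_box:
  assumes "l \<in> L'" "L' \<subseteq> L" "l \<notin> B" "B \<subseteq> L"
  shows "act (1 - Poly_Mapping.single (scl (of_nat (p l)) (G l)) 1) (series (box_points n L G g0 p L' B))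
    = (series (box_points n L G g0 p L' (insert l B)) :: _ \<Rightarrow> 'k::field_char_0)"
proof
  fix V
  let ?d = "scl (of_nat (p l)) (G l)"
  have l: "l \<in> L" using assms by blast
  have coord: "Poly_Mapping.lookup (V - ?d) l' = Poly_Mapping.lookup V l' - (if l = l' then of_nat (p l) else 0)"
    if "l' \<in> L" for l'
    using that l by (simp add: lookup_minus unit_coord)
  have *: "V - ?d \<in> box_points n L G g0 p L' B \<longleftrightarrow>
      V \<in> box_points n L G g0 p L' B \<and> of_nat (p l) \<le> Poly_Mapping.lookup V l"
  proof -
    have B: "(\<forall>l'\<in>B. Poly_Mapping.lookup (V - ?d) l' < of_nat (p l')) \<longleftrightarrow>
        (\<forall>l'\<in>B. Poly_Mapping.lookup V l' < of_nat (p l'))"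
    proof (intro ball_cong refl)
      fix l' assume "l' \<in> B"
      then have "l' \<in> L" "l' \<noteq> l" using assms by auto
      then show "(Poly_Mapping.lookup (V - ?d) l' < of_nat (p l')) = (Poly_Mapping.lookup V l' < of_nat (p l'))"
        using coord by simp
    qed
    have L': "(\<forall>l'\<in>L'. 0 \<le> Poly_Mapping.lookup (V - ?d) l') \<longleftrightarrow>
        (\<forall>l'\<in>L'. 0 \<le> Poly_Mapping.lookup V l') \<and> of_nat (p l) \<le> Poly_Mapping.lookup V l"
    proof -
      have "(\<forall>l'\<in>L'. 0 \<le> Poly_Mapping.lookup (V - ?d) l') \<longleftrightarrow>
          (\<forall>l'\<in>L'. (if l = l' then of_nat (p l) else 0) \<le> Poly_Mapping.lookup V l')"
        using coord assms(2) by (intro ball_cong refl) (auto simp: subset_iff)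
      also have "\<dots> \<longleftrightarrow> (\<forall>l'\<in>L'. 0 \<le> Poly_Mapping.lookup V l') \<and> of_nat (p l) \<le> Poly_Mapping.lookup V l"
        using assms(1) by (auto split: if_splits intro: order_trans[OF of_nat_0_le_iff])
      finally show ?thesis .
    qed
    show ?thesis
      unfolding box_points_def cone_points_def by (auto simp: affine_minus_iff[OF l] B L')
  qed
  have "act (1 - Poly_Mapping.single ?d 1) (series (box_points n L G g0 p L' B)) V =
      (series (box_points n L G g0 p L' B) V - series (box_points n L G g0 p L' B) (V - ?d) :: 'k)"
    by (simp add: act_minus act_single)
  also have "\<dots> = series (box_points n L G g0 p L' (insert l B)) V"
    unfolding series_def * by (auto simp: box_points_def)
  finally show "act (1 - Poly_Mapping.single ?d 1) (series (box_points n L G g0 p L' B)) V =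
    (series (box_points n L G g0 p L' (insert l B)) V :: 'k)" .
qed

text \<open>The generating function of a simplicial cone with its denominators cleared; each factor
  imposes one upper bound.\<close>

lemma act_den_cone:
  assumes "L' \<subseteq> L"
  shows "act (X L') (series (cone_points n L G g0 L'))
    = (series (box_points n L G g0 p L' L') :: _ \<Rightarrow> 'k::field_char_0)"
proof -
  have "finite L'" using assms finite_gens finite_subset by blast
  moreover have "act (X B) (series (cone_points n L G g0 L'))
      = (series (box_points n L G g0 p L' B) :: _ \<Rightarrow> 'k)" if "finite B" "B \<subseteq> L'" for B
    using that
  proof (induction B rule: finite_induct)
    case empty
    then show ?case by (simp add: X_def box_points_def)
  next
    case (insert l B)
    then have "act (X (insert l B)) (series (cone_points n L G g0 L')) =
        act (1 - Poly_Mapping.single (scl (of_nat (p l)) (G l)) 1)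
          (series (box_points n L G g0 p L' B) :: _ \<Rightarrow> 'k)"
      by (simp add: X_def act_mult)
    then show ?case
      using insert assms by (subst (asm) act_step_box) auto
  qed
  ultimately show ?thesis by blast
qed

text \<open>A point is determined by its coordinates in \<open>L\<close>, and these are integers in
  \<open>[0, p l)\<close>.\<close>

lemma finite_box: "finite (box_points n L G g0 p L L)"
proof (rule finite_subset)
  show "box_points n L G g0 p L L \<subseteq>
      (\<lambda>f. g0 + (\<Sum>l\<in>L. scl (f l) (G l))) ` (\<Pi>\<^sub>E l\<in>L. of_nat ` {..<p l})"
  proof
    fix V assume V: "V \<in> box_points n L G g0 p L L"
    let ?f = "restrict (Poly_Mapping.lookup V) L"
    have "Poly_Mapping.lookup V l \<in> of_nat ` {..<p l}" if "l \<in> L" for l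
    proof -
      have *: "Poly_Mapping.lookup V l \<in> \<int>" "0 \<le> Poly_Mapping.lookup V l" "Poly_Mapping.lookup V l < of_nat (p l)"
        using V L_less that by (auto simp: box_points_def cone_points_def affine_points_def)
      then obtain k where k: "Poly_Mapping.lookup V l = of_int k" by (elim Ints_cases)
      have "k \<ge> 0" using *(2) unfolding k by simp
      then have k': "Poly_Mapping.lookup V l = of_nat (nat k)" using k by (simp add: of_nat_nat)
      then have "nat k < p l" using *(3) by simp
      with k' show ?thesis by blast
    qed
    then have "?f \<in> (\<Pi>\<^sub>E l\<in>L. of_nat ` {..<p l})" by auto
    moreover have "V = g0 + (\<Sum>l\<in>L. scl (?f l) (G l))"
      using V by (simp add: box_points_def cone_points_def affine_points_def)
    ultimately show "V \<in> (\<lambda>f. g0 + (\<Sum>l\<in>L. scl (f l) (G l))) ` (\<Pi>\<^sub>E l\<in>L. of_nat ` {..<p l})"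
      by blast
  qed
qed (intro finite_imageI finite_PiE finite_gens, simp)

definition box_poly :: "(nat \<Rightarrow>\<^sub>0 rat) \<Rightarrow>\<^sub>0 'k::field_char_0" where
  "box_poly = Abs_poly_mapping (series (box_points n L G g0 p L L))"

lemma lookup_box_poly: "Poly_Mapping.lookup box_poly = series (box_points n L G g0 p L L)"
  unfolding box_poly_def using finite_box by (simp add: series_def)

end

section \<open>Constant term extraction from a lattice cone\<close>

locale lattice_ct_step = ct_step v j L G p + lattice_cone n L G g0 p for v j n L G g0 p +
  assumes n_le_v: "n \<le> v" and g0_coord: "l \<in> L \<Longrightarrow> Poly_Mapping.lookup g0 l = 0"
begin

lemma X_eq_den: "X L' = den L'"
  by (simp add: X_def den_def d_def)

lemma d_eq: "scl (of_nat (p l)) (G l) = d l"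
  by (simp add: d_def)

lemma affine_minus_multiple:
  "V - scl (of_int k) (d j) \<in> affine_points n L G g0 \<longleftrightarrow> V \<in> affine_points n L G g0"
  using periodic_scl_int[OF affine_periodic[OF j_in_L], of k] unfolding periodic_def d_eq by blast

lemma lookup_minus_multiple:
  "l \<in> L \<Longrightarrow> Poly_Mapping.lookup (V - scl (of_int k) (d j)) l =
     Poly_Mapping.lookup V l - (if l = j then of_int k * of_nat (p j) else 0)"
  by (simp add: lookup_minus lookup_d j_in_L)

text \<open>Every point with unrestricted \<open>j\<close>th coordinate is translated into the box by exactly one
  multiple of \<open>d j\<close>.\<close>

lemma act_box_comb:
  "act box_poly comb = (series (box_points n L G g0 p (L - {j}) (L - {j})) :: _ \<Rightarrow> 'k::field_char_0)"
proof
  fix V :: "nat \<Rightarrow>\<^sub>0 rat"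
  let ?K = "box_points n L G g0 p L L"
  let ?K' = "box_points n L G g0 p (L - {j}) (L - {j})"
  \<comment> \<open>Division of coordinate \<open>j\<close> by \<open>p j\<close>: \<open>k\<close>
    is the quotient, and the remainder is coordinate \<open>j\<close> of \<open>V0\<close>.\<close>
  define k where "k = \<lfloor>Poly_Mapping.lookup V j / of_nat (p j)\<rfloor>"
  define V0 where "V0 = V - scl (of_int k) (d j)"
  have pj: "(0::rat) < of_nat (p j)" using p_pos[OF j_in_L] by simp
  have coord: "V - scl (of_int i) (d j) \<in> ?K \<longleftrightarrow> V \<in> ?K' \<and>
      0 \<le> Poly_Mapping.lookup V j - of_int i * of_nat (p j) \<and>
      Poly_Mapping.lookup V j - of_int i * of_nat (p j) < of_nat (p j)" for i :: int
  proof -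
    have "(\<forall>l\<in>L. P l) \<longleftrightarrow> (\<forall>l\<in>L-{j}. P l) \<and> P j" for P using j_in_L by blast
    note split = this
    have "(\<forall>l\<in>L - {j}. Q l (Poly_Mapping.lookup (V - scl (of_int i) (d j)) l)) \<longleftrightarrow>
        (\<forall>l\<in>L - {j}. Q l (Poly_Mapping.lookup V l))" for Q :: "nat \<Rightarrow> rat \<Rightarrow> bool"
      by (intro ball_cong refl) (simp add: lookup_minus_multiple)
    note other = this[of "\<lambda>_ x. 0 \<le> x"] this[of "\<lambda>l x. x < of_nat (p l)"]
    show ?thesis
      unfolding box_points_def cone_points_def
      by (auto simp: affine_minus_multiple split other lookup_minus_multiple[OF j_in_L])
  qed
  have floor_unique': "i = k" if "0 \<le> Poly_Mapping.lookup V j - of_int i * of_nat (p j)"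
    "Poly_Mapping.lookup V j - of_int i * of_nat (p j) < of_nat (p j)" for i :: int
    unfolding k_def using that pj
    by (intro floor_unique[symmetric]) (simp_all add: field_simps)
  have k_ok: "0 \<le> Poly_Mapping.lookup V j - of_int k * of_nat (p j)"
    "Poly_Mapping.lookup V j - of_int k * of_nat (p j) < of_nat (p j)"
    using floor_correct[of "Poly_Mapping.lookup V j / of_nat (p j)"] pj
    unfolding k_def[symmetric] by (simp_all add: field_simps)
  have V0: "V0 \<in> ?K \<longleftrightarrow> V \<in> ?K'" unfolding V0_def coord using k_ok by simp
  have comb: "comb (V - e) = (if e = V0 then 1 else (0 :: 'k))" if e: "e \<in> ?K" for e
  proof -
    have "e = V0" if "V - e = scl (of_int i) (d j)" for i :: int
    proof -
      have e': "e = V - scl (of_int i) (d j)" using that by (simp add: algebra_simps)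
      then have "i = k" using e coord[of i] floor_unique'[of i] by simp
      then show ?thesis using e' by (simp add: V0_def)
    qed
    moreover have "V - V0 = scl (of_int k) (d j)" by (simp add: V0_def)
    ultimately have "(\<exists>i::int. V - e = scl (of_int i) (d j)) \<longleftrightarrow> e = V0" by metis
    then show ?thesis by (simp add: comb_def)
  qed
  have "act box_poly comb V = (\<Sum>e\<in>?K. series ?K e * (comb (V - e) :: 'k))"
    by (subst act_superset[OF finite_box]) (auto simp: in_keys_iff lookup_box_poly series_def split: if_splits)
  also have "\<dots> = (\<Sum>e\<in>?K. if e = V0 then 1 else 0)"
    by (intro sum.cong) (simp_all add: comb series_def)
  also have "\<dots> = (if V0 \<in> ?K then 1 else 0)"
    using finite_box by simp
  also have "\<dots> = series ?K' V" by (simp add: V0 series_def)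
  finally show "act box_poly comb V = (series ?K' V :: 'k)" .
qed

text \<open>The \<open>g\<close> asked for by \<open>CT_represents\<close> is the indicator of the
  cone with the bound on coordinate \<open>j\<close> dropped, times \<open>c\<close>; the scalar
  \<open>c\<close> carries the sign accumulated so far.\<close>

lemma CT_represents_cone:
  fixes F :: "'k::field_char_0 frac_rat_fun"
  assumes "represents (\<lambda>e. c * series (cone_points n L G g0 L) e) F"
  shows "represents (\<lambda>e. (if b j < 0 then - 1 else 1) * c * restrict_free v (series (cone_points n L G g0 (L - {j}))) e)
    (CT v j L u b p F)"
proof -
  define N where "N = Poly_Mapping.single 0 c * (box_poly :: _ \<Rightarrow>\<^sub>0 'k)"
  have "act (den L) (\<lambda>e. c * series (cone_points n L G g0 L) e) = Poly_Mapping.lookup N"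
    using act_den_cone[OF order_refl, where 'k='k]
    by (simp add: act_fun_scale N_def X_eq_den act_single flip: lookup_box_poly act_lookup)
  then have F: "F = emb N / emb (den L)"
    by (intro represents_unique[OF assms] represents_emb den_neq_0) auto
  define g :: "(nat \<Rightarrow>\<^sub>0 rat) \<Rightarrow> 'k" where "g = (\<lambda>e. c * series (cone_points n L G g0 (L - {j})) e)"
  have "periodic g (d j)"
  proof -
    have "V - d j \<in> cone_points n L G g0 (L - {j}) \<longleftrightarrow> V \<in> cone_points n L G g0 (L - {j})" for V
      using affine_minus_multiple[of V 1] lookup_minus_multiple[of _ V 1]
      by (simp add: cone_points_def scl_simps)
    then show ?thesis by (simp add: periodic_def g_def series_def)
  qed
  moreover have "act (den (L - {j})) g = act N comb"
    unfolding g_def act_fun_scale N_def act_mult act_box_comb act_single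
    using act_den_cone[of "L - {j}", where 'k='k] by (simp add: X_eq_den)
  ultimately have "represents (\<lambda>e. (if b j < 0 then - 1 else 1) * restrict_free v g e) (CT v j L u b p F)"
    by (rule CT_represents[OF F])
  also have "(\<lambda>e. (if b j < 0 then - 1 else 1) * restrict_free v g e) =
      (\<lambda>e. (if b j < 0 then - 1 else 1) * c * restrict_free v (series (cone_points n L G g0 (L - {j}))) e)"
    by (simp add: fun_eq_iff g_def restrict_free_def)
  finally show ?thesis .
qed

text \<open>Integrality of coordinate \<open>j\<close> remains a condition on the right although
  \<open>j\<close> has left the generators. This is the effect of the operator Z for
  \<open>y_j\<close>.\<close>

lemma restrict_cone:
  assumes G': "\<And>l. l \<in> L - {j} \<Longrightarrow> G' l = G l - scl (Poly_Mapping.lookup (G l) v / Poly_Mapping.lookup (G j) v) (G j)"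
    and g0': "g0' = g0 - scl (Poly_Mapping.lookup g0 v / Poly_Mapping.lookup (G j) v) (G j)"
  shows "restrict_free v (series (cone_points n L G g0 (L - {j}))) =
    (series (cone_points n (L - {j}) G' g0' (L - {j})) :: _ \<Rightarrow> 'k::field_char_0)"
proof -
  have "Poly_Mapping.lookup V v = 0 \<and> V = g0 + (\<Sum>l\<in>L. scl (Poly_Mapping.lookup V l) (G l)) \<longleftrightarrow>
      V = g0' + (\<Sum>l\<in>L-{j}. scl (Poly_Mapping.lookup V l) (G' l))" for V
  proof -
    \<comment> \<open>\<open>W\<close> is the point without its share of \<open>G j\<close>, and
      \<open>c\<close> is the multiple of \<open>G j\<close> that cancels the \<open>v\<close>
      exponent of \<open>W\<close>.\<close>
    define W where "W = g0 + (\<Sum>l\<in>L-{j}. scl (Poly_Mapping.lookup V l) (G l))"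
    define c where "c = - Poly_Mapping.lookup W v / Poly_Mapping.lookup (G j) v"
    have 1: "g0 + (\<Sum>l\<in>L. scl (Poly_Mapping.lookup V l) (G l)) = W + scl (Poly_Mapping.lookup V j) (G j)"
      unfolding W_def using finite_L j_in_L by (simp add: sum.remove[of L j] algebra_simps)
    have 2: "g0' + (\<Sum>l\<in>L-{j}. scl (Poly_Mapping.lookup V l) (G' l)) = W + scl c (G j)"
    proof (rule poly_mapping_eqI)
      fix s
      have "(\<Sum>l\<in>L-{j}. Poly_Mapping.lookup V l * Poly_Mapping.lookup (G' l) s) =
        (\<Sum>l\<in>L-{j}. Poly_Mapping.lookup V l * Poly_Mapping.lookup (G l) s) -
        (\<Sum>l\<in>L-{j}. Poly_Mapping.lookup V l * Poly_Mapping.lookup (G l) v) / Poly_Mapping.lookup (G j) v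
          * Poly_Mapping.lookup (G j) s"
        by (simp add: G' lookup_minus right_diff_distrib sum_subtractf sum_divide_distrib sum_distrib_right
            mult.assoc)
      then show "Poly_Mapping.lookup (g0' + (\<Sum>l\<in>L-{j}. scl (Poly_Mapping.lookup V l) (G' l))) s =
          Poly_Mapping.lookup (W + scl c (G j)) s"
        using pivot by (simp add: g0' W_def c_def lookup_add lookup_minus lookup_sum field_simps)
    qed
    \<comment> \<open>Needed for the way back: coordinate \<open>j\<close> of
      \<open>W + scl c (G j)\<close> is then \<open>c\<close> itself.\<close>
    have Wj: "Poly_Mapping.lookup W j = 0"
      unfolding W_def using j_in_L by (simp add: lookup_add lookup_sum g0_coord diag)
    show ?thesis unfolding 1 2
    proof
      assume *: "Poly_Mapping.lookup V v = 0 \<and> V = W + scl (Poly_Mapping.lookup V j) (G j)"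
      then have "0 = Poly_Mapping.lookup W v + Poly_Mapping.lookup V j * Poly_Mapping.lookup (G j) v"
        by (metis lookup_add lookup_scl)
      then have "Poly_Mapping.lookup V j = c"
        unfolding c_def using pivot by (simp add: field_simps)
      then show "V = W + scl c (G j)" using * by simp
    next
      assume *: "V = W + scl c (G j)"
      have "Poly_Mapping.lookup V v = Poly_Mapping.lookup W v + c * Poly_Mapping.lookup (G j) v"
        using arg_cong[OF *, of "\<lambda>e. Poly_Mapping.lookup e v"] by (simp add: lookup_add)
      then have "Poly_Mapping.lookup V v = 0" unfolding c_def using pivot by simp
      moreover have "Poly_Mapping.lookup V j = c"
        using arg_cong[OF *, of "\<lambda>e. Poly_Mapping.lookup e j"] Wj diag[OF j_in_L j_in_L] by (simp add: lookup_add)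
      ultimately show "Poly_Mapping.lookup V v = 0 \<and> V = W + scl (Poly_Mapping.lookup V j) (G j)"
        using * by simp
    qed
  qed
  then show ?thesis
    by (auto simp: fun_eq_iff restrict_free_def series_def cone_points_def affine_points_def)
qed

end

section \<open>Pivoting\<close>

lemma set_take_Suc: "k < length xs \<Longrightarrow> set (take (Suc k) xs) = insert (xs ! k) (set (take k xs))"
  by (simp add: take_Suc_conv_app_nth)

lemma nth_notin_set_take: "distinct xs \<Longrightarrow> k < length xs \<Longrightarrow> xs ! k \<notin> set (take k xs)"
  by (auto simp: in_set_conv_nth nth_eq_iff_index_eq)

lemma prod_signs:
  fixes x :: "nat \<Rightarrow> rat"
  assumes "\<And>i. i < k \<Longrightarrow> x i \<noteq> 0"
  shows "(\<Prod>i<k. if x i < 0 then - 1 else 1) = (if (\<Prod>i<k. x i) < 0 then - 1 else (1 :: 'k::comm_ring_1))"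
  using assms
proof (induction k)
  case (Suc k)
  have "(\<Prod>i<k. x i) \<noteq> 0" using Suc.prems by auto
  then show ?case
    using Suc.IH Suc.prems[of k] Suc.prems by (auto simp: mult_less_0_iff not_less order.order_iff_strict)
qed simp

section \<open>Exponent matrices along the elimination\<close>

locale elimination =
  fixes A :: "int mat" and rhs :: "int vec" and n r :: nat and il jl :: "nat list"
  assumes A: "A \<in> carrier_mat r n"
    and il: "length il = r" "distinct il" "set il \<subseteq> {..<r}"
    and jl: "length jl = r" "distinct jl" "set jl \<subseteq> {..<n}"
    and pivots: "\<And>k. k < r \<Longrightarrow> reduced n (matM n r A rhs) il jl k $$ (n + il ! k, jl ! k) \<noteq> 0"
begin

definition R :: "nat \<Rightarrow> rat mat" where
  "R k = reduced n (matM n r A rhs) il jl k"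

definition piv :: "nat \<Rightarrow> rat" where
  "piv k = R k $$ (n + il ! k, jl ! k)"

definition cols :: "nat \<Rightarrow> nat set" where
  "cols k = {..<n} - set (take k jl)"

definition ex :: "nat \<Rightarrow> nat \<Rightarrow> (nat \<Rightarrow>\<^sub>0 rat)" where
  "ex k = column_exponent n r (R k) (set (take k il))"

lemma R_carrier: "R k \<in> carrier_mat (n + r) (Suc n)"
proof (induction k)
  case 0
  show ?case
    by (rule carrier_matI) (simp_all add: R_def matM_def carrier_matD[OF A])
next
  case (Suc k)
  then have "dim_row (R k) = n + r" "dim_col (R k) = Suc n" by simp_all
  then show ?case
    by (intro carrier_matI) (simp_all add: R_def pivot_step_def)
qed

lemma R_0:
  "s < n \<Longrightarrow> l < n \<Longrightarrow> R 0 $$ (s, l) = (if s = l then 1 else 0)"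
  "s < n \<Longrightarrow> R 0 $$ (s, n) = 0"
  "i < r \<Longrightarrow> l < n \<Longrightarrow> R 0 $$ (n + i, l) = of_int (A $$ (i, l))"
  using A by (auto simp: R_def matM_def)

lemma R_Suc:
  assumes "a < n + r" "s \<le> n"
  shows "R (Suc k) $$ (a, s) = (if s = jl ! k then R k $$ (a, s)
    else R k $$ (a, s) - R k $$ (n + il ! k, s) / piv k * R k $$ (a, jl ! k))"
  using assms R_carrier[of k] by (simp add: R_def piv_def pivot_step_def)

lemma piv_neq_0: "k < r \<Longrightarrow> piv k \<noteq> 0"
  using pivots by (simp add: piv_def R_def)

lemma il_less: "k < r \<Longrightarrow> il ! k < r"
  using subsetD[OF il(3) nth_mem[of k il]] il(1) by simp

lemma jl_less: "k < r \<Longrightarrow> jl ! k < n"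
  using subsetD[OF jl(3) nth_mem[of k jl]] jl(1) by simp

lemma jl_in_cols: "k < r \<Longrightarrow> jl ! k \<in> cols k"
  using jl_less jl nth_notin_set_take[of jl k] by (simp add: cols_def)

lemma cols_Suc: "k < r \<Longrightarrow> cols (Suc k) = cols k - {jl ! k}"
  using jl by (auto simp: cols_def set_take_Suc)

text \<open>A pivot step changes row \<open>s\<close> by multiples of its entry in the pivot column,
  which is 0 by induction. This supplies \<open>diag\<close> and \<open>g0_coord\<close> at every
  stage.\<close>

lemma R_unit:
  assumes "k \<le> r" "s \<in> cols k" "l \<in> insert n (cols k)"
  shows "R k $$ (s, l) = (if s = l then 1 else 0)"
  using assms
proof (induction k arbitrary: l)
  case 0
  then show ?case using R_0 by (auto simp: cols_def)
next
  case (Suc k)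
  have k: "k < r" using Suc.prems by simp
  have s: "s \<in> cols k" "s \<noteq> jl ! k" "s < n" and l: "l \<in> insert n (cols k)" "l \<noteq> jl ! k" "l \<le> n"
    using Suc.prems(2,3) jl_less[OF k] unfolding cols_Suc[OF k] by (auto simp: cols_def)
  have "R k $$ (s, jl ! k) = 0"
    using Suc.IH[of "jl ! k"] jl_in_cols[OF k] s k by simp
  then show ?case using Suc.IH[of l] s l k by (simp add: R_Suc)
qed

lemma lookup_ex: "Poly_Mapping.lookup (ex k l) s =
    (if s < n + r \<and> s \<notin> (+) n ` set (take k il) then R k $$ (s, l) else 0)"
proof -
  have "Poly_Mapping.lookup (ex k l) s =
      (\<Sum>s'\<in>{..<n + r} - (+) n ` set (take k il). if s' = s then R k $$ (s', l) else 0)"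
    by (simp add: ex_def column_exponent_def lookup_sum lookup_single when_def)
  then show ?thesis by (simp add: sum.delta)
qed

lemma lookup_ex_less: "s < n \<Longrightarrow> Poly_Mapping.lookup (ex k l) s = R k $$ (s, l)"
  by (auto simp: lookup_ex)

lemma lookup_ex_pivot_row: "k < r \<Longrightarrow> Poly_Mapping.lookup (ex k l) (n + il ! k) = R k $$ (n + il ! k, l)"
  using il_less[of k] il nth_notin_set_take[of il k] by (auto simp: lookup_ex)

text \<open>In row \<open>n + il ! k\<close> both sides vanish: on the left the row is now ignored,
  on the right the subtraction cancels it. Ignoring rows is thus compatible with pivoting.\<close>

lemma ex_Suc:
  assumes k: "k < r" and l: "l \<le> n" "l \<noteq> jl ! k"
  shows "ex (Suc k) l = ex k l - scl (Poly_Mapping.lookup (ex k l) (n + il ! k) /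
      Poly_Mapping.lookup (ex k (jl ! k)) (n + il ! k)) (ex k (jl ! k))"
proof (rule poly_mapping_eqI)
  fix s
  have "set (take (Suc k) il) = insert (il ! k) (set (take k il))"
    using k il by (simp add: set_take_Suc)
  moreover have "Poly_Mapping.lookup (ex k (jl ! k)) (n + il ! k) \<noteq> 0"
    using lookup_ex_pivot_row[OF k] piv_neq_0[OF k] by (simp add: piv_def)
  ultimately show "Poly_Mapping.lookup (ex (Suc k) l) s =
      Poly_Mapping.lookup (ex k l - scl (Poly_Mapping.lookup (ex k l) (n + il ! k) /
      Poly_Mapping.lookup (ex k (jl ! k)) (n + il ! k)) (ex k (jl ! k))) s"
    using k l lookup_ex_pivot_row[OF k] il_less[OF k]
    by (cases "s = n + il ! k")
       (auto simp: lookup_minus lookup_ex[of "Suc k"] lookup_ex[of k _ s] R_Suc piv_def)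
qed

text \<open>Each step combines \<open>CT_represents_cone\<close>, which frees coordinate
  \<open>jl ! k\<close>, with \<open>restrict_cone\<close>, which eliminates it; the step
  contributes the sign of its pivot.\<close>

lemma represents_iterated_CT:
  assumes p_pos: "\<And>k j. k < r \<Longrightarrow> j \<in> cols k \<Longrightarrow> p k j > 0"
    and p_integral: "\<And>k j s. k < r \<Longrightarrow> j \<in> cols k \<Longrightarrow> s < n \<Longrightarrow> of_nat (p k j) * R k $$ (s, j) \<in> \<int>"
    and "k \<le> r"
  shows "represents
    (\<lambda>V. (\<Prod>i<k. if piv i < 0 then - 1 else 1) * series (cone_points n (cols k) (ex k) (ex k n) (cols k)) V)
    (iterated_CT n r (matM n r A rhs) il jl p k :: 'k::field_char_0 frac_rat_fun)"
  using \<open>k \<le> r\<close>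
proof (induction k)
  case 0
  \<comment> \<open>Initially the generators have integral \<open>y\<close> exponents and the
    bracket has plain factors, so every power is 1. The parallelepiped then contains the apex
    alone.\<close>
  interpret lattice_cone n "cols 0" "ex 0" "ex 0 n" "\<lambda>_. 1"
    by unfold_locales (auto simp: cols_def lookup_ex_less R_0)
  have "V \<in> box_points n (cols 0) (ex 0) (ex 0 n) (\<lambda>_. 1) (cols 0) (cols 0) \<longleftrightarrow> V = ex 0 n" for V
  proof
    assume V: "V \<in> box_points n (cols 0) (ex 0) (ex 0 n) (\<lambda>_. 1) (cols 0) (cols 0)"
    have "Poly_Mapping.lookup V l = 0" if l: "l \<in> cols 0" for l
    proof -
      have *: "Poly_Mapping.lookup V l \<in> \<int>" "0 \<le> Poly_Mapping.lookup V l" "Poly_Mapping.lookup V l < 1"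
        using V l by (auto simp: box_points_def cone_points_def affine_points_def cols_def)
      then obtain i where i: "Poly_Mapping.lookup V l = of_int i" by (elim Ints_cases)
      with * show ?thesis by simp
    qed
    then show "V = ex 0 n"
      using V by (simp add: box_points_def cone_points_def affine_points_def scl_simps)
  next
    assume "V = ex 0 n"
    then have "Poly_Mapping.lookup V l = 0" if "l < n" for l
      using that by (simp add: lookup_ex_less R_0)
    then show "V \<in> box_points n (cols 0) (ex 0) (ex 0 n) (\<lambda>_. 1) (cols 0) (cols 0)"
      using \<open>V = ex 0 n\<close>
      by (simp add: box_points_def cone_points_def affine_points_def scl_simps cols_def)
  qed
  then have "series (box_points n (cols 0) (ex 0) (ex 0 n) (\<lambda>_. 1) (cols 0) (cols 0))
      = Poly_Mapping.lookup (Poly_Mapping.single (ex 0 n) (1 :: 'k))"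
    by (auto simp: fun_eq_iff series_def lookup_single when_def)
  then have "act (X (cols 0)) (series (cone_points n (cols 0) (ex 0) (ex 0 n) (cols 0))) =
      Poly_Mapping.lookup (Poly_Mapping.single (ex 0 n) (1 :: 'k))"
    using act_den_cone[OF order_refl, where 'k='k] by simp
  moreover have "X (cols 0) \<noteq> (0 :: _ \<Rightarrow>\<^sub>0 'k)"
  proof -
    have "ex 0 l \<noteq> 0" if "l \<in> cols 0" for l
      using unit_coord[OF that that] by auto
    then show ?thesis
      using finite_gens unfolding X_def by (auto simp: scl_simps)
  qed
  ultimately have "represents (series (cone_points n (cols 0) (ex 0) (ex 0 n) (cols 0)))
      (emb (Poly_Mapping.single (ex 0 n) (1 :: 'k)) / emb (X (cols 0)))"
    by (intro represents_emb)
  also have "emb (X (cols 0)) = (\<Prod>l\<in>cols 0. 1 - (monom_fun (ex 0 l) :: 'k frac_rat_fun))"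
    unfolding X_def emb_prod by (simp only: emb_simps monom_fun_def of_nat_1 scl_simps)
  also have "emb (Poly_Mapping.single (ex 0 n) (1 :: 'k)) / \<dots> = iterated_CT n r (matM n r A rhs) il jl p 0"
    by (simp add: bracket_def cols_def ex_def R_def monom_fun_def)
  finally show ?case by simp
next
  case (Suc k)
  then have k: "k < r" by simp
  let ?v = "n + il ! k"
  interpret lattice_ct_step ?v "jl ! k" n "cols k" "ex k" "ex k n" "p k"
    using k jl_in_cols[OF k] p_pos[OF k] p_integral[OF k] R_unit[of k] piv_neq_0[OF k]
    by unfold_locales (auto simp: lookup_ex_less lookup_ex_pivot_row cols_def piv_def)
  have ub: "u = (\<lambda>l. monom_fun (ex k l - Poly_Mapping.single ?v (Poly_Mapping.lookup (ex k l) ?v)) :: 'k frac_rat_fun)"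
      "b = (\<lambda>l. Poly_Mapping.lookup (ex k l) ?v)"
    by (simp_all add: fun_eq_iff u_def b_def)
  have CT: "iterated_CT n r (matM n r A rhs) il jl p (Suc k) =
      (CT ?v (jl ! k) (cols k) u b (p k) (iterated_CT n r (matM n r A rhs) il jl p k) :: 'k frac_rat_fun)"
    unfolding ub by (simp add: Let_def cols_def ex_def R_def)
  have bj: "b (jl ! k) = piv k"
    using k by (simp add: b_def lookup_ex_pivot_row piv_def)
  have restr: "restrict_free ?v (series (cone_points n (cols k) (ex k) (ex k n) (cols k - {jl ! k}))) =
      (series (cone_points n (cols (Suc k)) (ex (Suc k)) (ex (Suc k) n) (cols (Suc k))) :: _ \<Rightarrow> 'k)"
    unfolding cols_Suc[OF k]
    by (rule restrict_cone) (use k jl_less[OF k] in \<open>auto intro!: ex_Suc simp: cols_def\<close>)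
  have "represents (\<lambda>V. (\<Prod>i<k. if piv i < 0 then - 1 else 1) *
      series (cone_points n (cols k) (ex k) (ex k n) (cols k)) V)
      (iterated_CT n r (matM n r A rhs) il jl p k :: 'k frac_rat_fun)"
    using Suc by simp
  from CT_represents_cone[OF this] show ?case
    unfolding CT restr bj by (simp add: mult.commute)
qed

section \<open>The minor of \<open>A\<close> as the product of the pivots\<close>

lemma R_pivot_row:
  assumes "k \<le> r" "i < k" "s \<le> n"
  shows "R k $$ (n + il ! i, s) = (if s = jl ! i then piv i else 0)"
  using assms
proof (induction k arbitrary: s)
  case (Suc k)
  have k: "k < r" and i: "i < r" "il ! i < r" using Suc.prems il_less by auto
  show ?case
  proof (cases "i = k")
    case True
    then show ?thesis
      using Suc.prems i piv_neq_0[OF k] by (simp add: R_Suc piv_def)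
  next
    case False
    then have "i < k" using Suc.prems by simp
    moreover have "jl ! k \<noteq> jl ! i"
      using False k i jl nth_eq_iff_index_eq by metis
    moreover have "jl ! k \<le> n" using jl_less[OF k] by simp
    \<comment> \<open>The later pivot column has entry 0 in row \<open>n + il ! i\<close>, so this
      row is not changed any more.\<close>
    ultimately show ?thesis
      using Suc.IH[of s] Suc.IH[of "jl ! k"] Suc.prems i by (auto simp: R_Suc)
  qed
qed simp

definition pivot_minor :: "nat \<Rightarrow> rat mat" where
  "pivot_minor k = mat r r (\<lambda>(s, t). R k $$ (n + il ! s, jl ! t))"

lemma det_pivot_minor_Suc:
  assumes k: "k < r"
  shows "det (pivot_minor (Suc k)) = det (pivot_minor k)"
proof -
  \<comment> \<open>The pivot step as right multiplication: identity, except that row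
    \<open>k\<close> holds the multiples of the pivot column to be added.\<close>
  define T :: "rat mat" where
    "T = mat r r (\<lambda>(i, t). if i = t then 1 else if i = k then - R k $$ (n + il ! k, jl ! t) / piv k else 0)"
  have T: "T \<in> carrier_mat r r" and P: "pivot_minor k \<in> carrier_mat r r" for k
    by (simp_all add: T_def pivot_minor_def)
  have "pivot_minor (Suc k) = pivot_minor k * T"
  proof (rule eq_matI)
    fix s t assume "s < dim_row (pivot_minor k * T)" "t < dim_col (pivot_minor k * T)"
    then have st: "s < r" "t < r" by (simp_all add: pivot_minor_def T_def)
    have "(pivot_minor k * T) $$ (s, t) =
        (\<Sum>i<r. R k $$ (n + il ! s, jl ! i) *
          (if i = t then 1 else if i = k then - R k $$ (n + il ! k, jl ! t) / piv k else 0))"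
      using st by (simp add: pivot_minor_def T_def scalar_prod_def atLeast0LessThan)
    also have "\<dots> = (\<Sum>i<r. (if i = t then R k $$ (n + il ! s, jl ! t) else 0) +
        (if i = k then (if k = t then 0 else
          R k $$ (n + il ! s, jl ! k) * (- R k $$ (n + il ! k, jl ! t) / piv k)) else 0))"
      by (intro sum.cong) auto
    also have "\<dots> = R k $$ (n + il ! s, jl ! t) + (if k = t then 0 else
          R k $$ (n + il ! s, jl ! k) * (- R k $$ (n + il ! k, jl ! t) / piv k))"
      using st k by (simp add: sum.distrib)
    also have "\<dots> = pivot_minor (Suc k) $$ (s, t)"
    proof -
      have "jl ! t = jl ! k \<longleftrightarrow> t = k"
        using st k jl nth_eq_iff_index_eq by metis
      then show ?thesis
        using st il_less[of s] jl_less[of t] by (simp add: pivot_minor_def R_Suc)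
    qed
    finally show "pivot_minor (Suc k) $$ (s, t) = (pivot_minor k * T) $$ (s, t)" by simp
  qed (simp_all add: pivot_minor_def T_def)
  moreover have "det T = 1"
  proof -
    \<comment> \<open>Column \<open>k\<close> of \<open>T\<close> is a unit vector, and deleting row
      and column \<open>k\<close> leaves an identity matrix.\<close>
    have "det T = (\<Sum>i<r. T $$ (i, k) * cofactor T i k)"
      by (rule laplace_expansion_column[OF T k])
    also have "\<dots> = (\<Sum>i<r. if i = k then cofactor T k k else 0)"
      using k by (intro sum.cong) (auto simp: T_def)
    also have "\<dots> = cofactor T k k" using k by simp
    also have "mat_delete T k k = 1\<^sub>m (r - 1)"
      by (rule eq_matI) (use k in \<open>auto simp: mat_delete_def T_def\<close>)
    then have "cofactor T k k = 1"
      by (simp add: cofactor_def)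
    finally show ?thesis .
  qed
  ultimately show ?thesis
    by (simp add: det_mult[OF P T])
qed

text \<open>Column operations preserve the determinant, and with rows and columns in pivot order
  \<open>R_pivot_row\<close> makes the final minor diagonal.\<close>

lemma of_int_det_eq_prod_piv:
  "of_int (det (mat r r (\<lambda>(s, t). A $$ (il ! s, jl ! t)))) = (\<Prod>k<r. piv k)"
proof -
  have "det (pivot_minor k) = det (pivot_minor 0)" if "k \<le> r" for k
    using that by (induction k) (simp_all add: det_pivot_minor_Suc)
  from this[OF order_refl] have "det (pivot_minor 0) = det (pivot_minor r)" by (rule sym)
  also have "\<dots> = prod_list (diag_mat (pivot_minor r))"
  proof (rule det_upper_triangular)
    show "upper_triangular (pivot_minor r)"
    proof (rule upper_triangularI)
      fix i j assume ij: "j < i" "i < dim_row (pivot_minor r)"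
      then have "jl ! j \<noteq> jl ! i" "jl ! j < n"
        using jl nth_eq_iff_index_eq[of jl j i] jl_less[of j] by (auto simp: pivot_minor_def)
      then show "pivot_minor r $$ (i, j) = 0"
        using ij by (simp add: pivot_minor_def R_pivot_row)
    qed
    show "pivot_minor r \<in> carrier_mat r r" by (simp add: pivot_minor_def)
  qed
  also have "\<dots> = (\<Prod>k<r. piv k)"
    unfolding prod_list_diag_prod
    using jl_less by (auto simp: pivot_minor_def R_pivot_row atLeast0LessThan less_imp_le intro!: prod.cong)
  also have "pivot_minor 0 = map_mat of_int (mat r r (\<lambda>(s, t). A $$ (il ! s, jl ! t)))"
    by (rule eq_matI) (auto simp: pivot_minor_def R_0 il_less jl_less)
  finally show ?thesis
    by (simp add: of_int_hom.hom_det)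
qed

section \<open>The cone of the final matrix\<close>

definition cone_mat :: "rat mat" where
  "cone_mat = submatrix (R r) {..<n} (- set jl)"

lemma card_jl: "card (set jl) = r" "r \<le> n"
  using jl card_mono[of "{..<n}" "set jl"] by (simp_all add: distinct_card)

lemma cols_r: "cols r = {..<n} - set jl"
  using jl by (simp add: cols_def)

text \<open>The increasing enumeration of the infinite set \<open>- set jl\<close> runs through
  \<open>cols r\<close> and then reaches \<open>n\<close>; so the apex column is the last column of
  the submatrix.\<close>

lemma pick_compl:
  shows "pick (- set jl) (n - r) = n" and "bij_betw (pick (- set jl)) {..<n - r} (cols r)"
proof -
  have "{a \<in> - set jl. a < n} = cols r" by (auto simp: cols_r)
  moreover have card: "card (cols r) = n - r"
    using jl card_jl by (simp add: cols_r card_Diff_subset)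
  ultimately show n: "pick (- set jl) (n - r) = n"
    using pick_card_in_set[of n "- set jl"] jl by auto
  have inf: "infinite (- set jl)" by (simp add: Compl_eq_Diff_UNIV infinite_UNIV_nat)
  have inj: "inj_on (pick (- set jl)) {..<n - r}"
    using pick_eq_iff_inf[OF inf] by (auto intro!: inj_onI)
  have "pick (- set jl) i \<in> cols r" if "i < n - r" for i
    using pick_in_set_inf[OF inf, of i] pick_mono_inf[OF inf that] n by (auto simp: cols_r)
  then have "pick (- set jl) ` {..<n - r} \<subseteq> cols r" by auto
  moreover have "card (pick (- set jl) ` {..<n - r}) = card (cols r)"
    using card_image[OF inj] card by simp
  ultimately have "pick (- set jl) ` {..<n - r} = cols r"
    by (intro card_subset_eq) (auto simp: cols_def)
  with inj show "bij_betw (pick (- set jl)) {..<n - r} (cols r)" by (simp add: bij_betw_def)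
qed

lemma cone_mat_simps:
  "dim_row cone_mat = n" "dim_col cone_mat - 1 = n - r"
  "s < n \<Longrightarrow> i \<le> n - r \<Longrightarrow> cone_mat $$ (s, i) = R r $$ (s, pick (- set jl) i)"
proof -
  have dr: "dim_row (R r) = n + r" "dim_col (R r) = Suc n" using R_carrier[of r] by auto
  have 1: "{i. i < dim_row (R r) \<and> i \<in> {..<n}} = {..<n}" by (auto simp: dr)
  have "{j. j < dim_col (R r) \<and> j \<in> - set jl} = insert n (cols r)"
    using jl by (auto simp: dr cols_r)
  moreover have "n \<notin> cols r" "finite (cols r)" "card (cols r) = n - r"
    using jl card_jl by (auto simp: cols_r card_Diff_subset)
  ultimately have 2: "card {j. j < dim_col (R r) \<and> j \<in> - set jl} = Suc (n - r)" by simp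
  show "dim_row cone_mat = n" "dim_col cone_mat - 1 = n - r"
    unfolding cone_mat_def dim_submatrix 1 2 by simp_all
  assume s: "s < n" and i: "i \<le> n - r"
  have "{a \<in> {..<n}. a < s} = {..<s}" using s by auto
  then have "pick {..<n} s = s" using pick_card_in_set[of s "{..<n}"] s by simp
  then show "cone_mat $$ (s, i) = R r $$ (s, pick (- set jl) i)"
    using submatrix_index[of s "R r" "{..<n}" i "- set jl"] s i unfolding cone_mat_def 1 2 by simp
qed

text \<open>On the rows in \<open>cols r\<close> the generators are the standard unit vectors, by
  \<open>R_unit\<close>.\<close>

lemma simplicial_cone_mat: "is_simplicial cone_mat"
  unfolding is_simplicial_def cone_mat_simps
proof (intro allI impI)
  fix c :: "nat \<Rightarrow> real" and i
  assume c: "\<forall>s<n. (\<Sum>i<n - r. c i * of_rat (cone_mat $$ (s, i))) = 0" and i: "i < n - r"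
  let ?\<pi> = "pick (- set jl)"
  have \<pi>: "?\<pi> i' \<in> cols r" if "i' < n - r" for i'
    using pick_compl(2) that by (auto simp: bij_betw_def)
  have "?\<pi> i < n" using \<pi>[OF i] by (simp add: cols_def)
  then have "0 = (\<Sum>i'<n - r. c i' * of_rat (cone_mat $$ (?\<pi> i, i')))" using c by simp
  also have "\<dots> = (\<Sum>i'<n - r. if i' = i then c i else 0)"
  proof (intro sum.cong refl)
    fix i' assume i': "i' \<in> {..<n - r}"
    have "?\<pi> i = ?\<pi> i' \<longleftrightarrow> i = i'"
      using pick_compl(2) i i' by (auto simp: bij_betw_def inj_on_def)
    then show "c i' * of_rat (cone_mat $$ (?\<pi> i, i')) = (if i' = i then c i else 0)"
      using i' \<pi>[OF i] \<pi>[of i'] \<open>?\<pi> i < n\<close> by (simp add: cone_mat_simps R_unit)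
  qed
  also have "\<dots> = c i" using i by simp
  finally show "c i = 0" by simp
qed

text \<open>Replaces the existential coefficients of the real cone by coordinates of the point, the
  form already used in \<open>affine_points\<close>.\<close>

lemma mem_shifted_cone_iff:
  assumes x: "x \<in> carrier_vec n"
  shows "x \<in> shifted_cone cone_mat \<longleftrightarrow>
    (\<forall>l\<in>cols r. 0 \<le> x $ l) \<and>
    (\<forall>s<n. x $ s = of_rat (R r $$ (s, n)) + (\<Sum>l\<in>cols r. x $ l * of_rat (R r $$ (s, l))))"
    (is "_ \<longleftrightarrow> ?R")
proof -
  let ?\<pi> = "pick (- set jl)"
  have reindex: "(\<Sum>i<n - r. f (?\<pi> i)) = (\<Sum>l\<in>cols r. f l)" for f :: "nat \<Rightarrow> real"
    using sum.reindex_bij_betw[OF pick_compl(2)] by simp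
  have cone_eq: "(of_rat (cone_mat $$ (s, n - r)) + (\<Sum>i<n - r. c i * of_rat (cone_mat $$ (s, i))) :: real) =
      of_rat (R r $$ (s, n)) + (\<Sum>i<n - r. c i * of_rat (R r $$ (s, ?\<pi> i)))" if "s < n" for s c
    using that by (simp add: cone_mat_simps pick_compl(1))
  show ?thesis
  proof
    assume "x \<in> shifted_cone cone_mat"
    then obtain c :: "nat \<Rightarrow> real" where c: "\<forall>i<n - r. c i \<ge> 0"
      and x_eq: "x = vec n (\<lambda>s. of_rat (cone_mat $$ (s, n - r)) + (\<Sum>i<n - r. c i * of_rat (cone_mat $$ (s, i))))"
      unfolding shifted_cone_def cone_mat_simps by blast
    have xs: "x $ s = of_rat (R r $$ (s, n)) + (\<Sum>i<n - r. c i * of_rat (R r $$ (s, ?\<pi> i)))" if "s < n" for s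
      using that by (simp add: x_eq cone_eq)
    \<comment> \<open>In row \<open>?\<pi> i\<close> the apex entry is 0 and only generator
      \<open>i\<close> has a nonzero entry, namely 1.\<close>
    have x\<pi>: "x $ ?\<pi> i = c i" if i: "i < n - r" for i
    proof -
      have \<pi>: "?\<pi> i' \<in> cols r" if "i' < n - r" for i'
        using pick_compl(2) that by (auto simp: bij_betw_def)
      have "?\<pi> i < n" using \<pi>[OF i] by (simp add: cols_def)
      have "(\<Sum>i'<n - r. c i' * of_rat (R r $$ (?\<pi> i, ?\<pi> i'))) = (\<Sum>i'<n - r. if i' = i then c i else 0)"
      proof (intro sum.cong refl)
        fix i' assume i': "i' \<in> {..<n - r}"
        have "?\<pi> i = ?\<pi> i' \<longleftrightarrow> i = i'"
          using pick_compl(2) i i' by (auto simp: bij_betw_def inj_on_def)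
        then show "c i' * of_rat (R r $$ (?\<pi> i, ?\<pi> i')) = (if i' = i then c i else 0)"
          using i' \<pi>[OF i] \<pi>[of i'] by (simp add: R_unit)
      qed
      then show ?thesis
        using xs[OF \<open>?\<pi> i < n\<close>] R_unit[of r "?\<pi> i" n] \<pi>[OF i] \<open>?\<pi> i < n\<close> i by simp
    qed
    show ?R
    proof (intro conjI ballI allI impI)
      fix l assume "l \<in> cols r"
      then obtain i where "i < n - r" "l = ?\<pi> i"
        using pick_compl(2) by (auto simp: bij_betw_def)
      then show "0 \<le> x $ l" using x\<pi> c by simp
    next
      fix s assume "s < n"
      have "(\<Sum>i<n - r. c i * of_rat (R r $$ (s, ?\<pi> i))) = (\<Sum>i<n - r. x $ ?\<pi> i * of_rat (R r $$ (s, ?\<pi> i)))"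
        by (intro sum.cong) (simp_all add: x\<pi>)
      then show "x $ s = of_rat (R r $$ (s, n)) + (\<Sum>l\<in>cols r. x $ l * of_rat (R r $$ (s, l)))"
        using xs[OF \<open>s < n\<close>] reindex[of "\<lambda>l. x $ l * of_rat (R r $$ (s, l))"] by simp
    qed
  next
    assume R: ?R
    have "x = vec n (\<lambda>s. of_rat (cone_mat $$ (s, n - r)) +
        (\<Sum>i<n - r. x $ ?\<pi> i * of_rat (cone_mat $$ (s, i))))"
    proof (rule eq_vecI)
      fix s assume "s < dim_vec (vec n (\<lambda>s. of_rat (cone_mat $$ (s, n - r)) +
        (\<Sum>i<n - r. x $ ?\<pi> i * of_rat (cone_mat $$ (s, i)))))"
      then have s: "s < n" by simp
      then show "x $ s = vec n (\<lambda>s. of_rat (cone_mat $$ (s, n - r)) +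
          (\<Sum>i<n - r. x $ ?\<pi> i * of_rat (cone_mat $$ (s, i)))) $ s"
        using R reindex[of "\<lambda>l. x $ l * of_rat (R r $$ (s, l))"] by (simp add: cone_eq)
    qed (use x in simp)
    moreover have "\<forall>i<n - r. x $ ?\<pi> i \<ge> 0"
      using R pick_compl(2) by (auto simp: bij_betw_def)
    ultimately show "x \<in> shifted_cone cone_mat"
      unfolding shifted_cone_def cone_mat_simps
      by (intro CollectI exI[of _ "\<lambda>i. x $ ?\<pi> i"] exI[of _ "n - r"]) simp
  qed
qed

lemma lookup_lattice_exponent:
  "Poly_Mapping.lookup (lattice_exponent \<alpha>) s = (if s < dim_vec \<alpha> then of_int (\<alpha> $ s) else 0)"
  by (simp add: lattice_exponent_def lookup_sum lookup_single when_def sum.delta)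

lemma lattice_series_cone:
  "lattice_series n (shifted_cone cone_mat) =
    (series (cone_points n (cols r) (ex r) (ex r n) (cols r)) :: _ \<Rightarrow> 'k::field_char_0)"
proof -
  \<comment> \<open>After \<open>r\<close> steps every \<lambda> row has been a pivot row, so only
    \<open>y\<close> exponents are left in \<open>ex r\<close>.\<close>
  have set_il: "set il = {..<r}"
    using il by (intro card_subset_eq) (simp_all add: distinct_card)
  have ex_r: "Poly_Mapping.lookup (ex r l) s = (if s < n then R r $$ (s, l) else 0)" for l s
  proof (cases "s < n")
    case True
    then show ?thesis by (simp add: lookup_ex_less)
  next
    case False
    then have "s < n + r \<Longrightarrow> s \<in> (+) n ` set (take r il)"
      using il set_il by (intro image_eqI[of _ _ "s - n"]) auto
    then show ?thesis using False by (auto simp: lookup_ex)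
  qed
  have affine_iff: "V \<in> affine_points n (cols r) (ex r) (ex r n) \<longleftrightarrow>
      (\<forall>s<n. Poly_Mapping.lookup V s \<in> \<int>) \<and> (\<forall>s\<ge>n. Poly_Mapping.lookup V s = 0) \<and>
      (\<forall>s<n. Poly_Mapping.lookup V s = R r $$ (s, n) + (\<Sum>l\<in>cols r. Poly_Mapping.lookup V l * R r $$ (s, l)))"
    for V
  proof -
    have "V = ex r n + (\<Sum>l\<in>cols r. scl (Poly_Mapping.lookup V l) (ex r l)) \<longleftrightarrow>
        (\<forall>s. Poly_Mapping.lookup V s = (if s < n then R r $$ (s, n) +
          (\<Sum>l\<in>cols r. Poly_Mapping.lookup V l * R r $$ (s, l)) else 0))"
      by (simp add: poly_mapping_eq_iff fun_eq_iff lookup_add lookup_sum ex_r)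
    also have "\<dots> \<longleftrightarrow> (\<forall>s\<ge>n. Poly_Mapping.lookup V s = 0) \<and>
      (\<forall>s<n. Poly_Mapping.lookup V s = R r $$ (s, n) + (\<Sum>l\<in>cols r. Poly_Mapping.lookup V l * R r $$ (s, l)))"
      by (meson not_less)
    finally show ?thesis by (simp add: affine_points_def)
  qed
  have mem: "map_vec of_int \<alpha> \<in> shifted_cone cone_mat \<longleftrightarrow>
      lattice_exponent \<alpha> \<in> cone_points n (cols r) (ex r) (ex r n) (cols r)"
    if \<alpha>: "\<alpha> \<in> carrier_vec n" for \<alpha>
  proof -
    have colsn: "l < n" if "l \<in> cols r" for l using that by (simp add: cols_def)
    \<comment> \<open>The cone is real and the exponents are rational; injectivity of
      \<open>of_rat\<close> carries the equations across.\<close>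
    have "(of_int (\<alpha> $ s) :: real) = of_rat (R r $$ (s, n)) + (\<Sum>l\<in>cols r. of_int (\<alpha> $ l) * of_rat (R r $$ (s, l)))
        \<longleftrightarrow> (of_int (\<alpha> $ s) :: rat) = R r $$ (s, n) + (\<Sum>l\<in>cols r. of_int (\<alpha> $ l) * R r $$ (s, l))" for s
    proof -
      have "(of_rat (of_int (\<alpha> $ s)) :: real) =
          of_rat (R r $$ (s, n) + (\<Sum>l\<in>cols r. of_int (\<alpha> $ l) * R r $$ (s, l))) \<longleftrightarrow>
          (of_int (\<alpha> $ s) :: rat) = R r $$ (s, n) + (\<Sum>l\<in>cols r. of_int (\<alpha> $ l) * R r $$ (s, l))"
        by (rule of_rat_eq_iff)
      then show ?thesis by (simp add: of_rat_add of_rat_sum of_rat_mult)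
    qed
    then show ?thesis
      using \<alpha> by (simp add: mem_shifted_cone_iff cone_points_def affine_iff lookup_lattice_exponent colsn cong: sum.cong)
        blast
  qed
  have surj: "\<exists>\<alpha>\<in>carrier_vec n. V = lattice_exponent \<alpha>"
    if V: "V \<in> cone_points n (cols r) (ex r) (ex r n) (cols r)" for V
  proof
    let ?\<alpha> = "vec n (\<lambda>s. \<lfloor>Poly_Mapping.lookup V s\<rfloor>)"
    show "V = lattice_exponent ?\<alpha>"
      using V by (intro poly_mapping_eqI)
        (auto simp: cone_points_def affine_iff lookup_lattice_exponent elim!: Ints_cases)
  qed simp
  show ?thesis
    using mem surj by (auto simp: fun_eq_iff lattice_series_def series_def)
qed

end

theorem theorem14:
  fixes A :: "int mat" and b :: "int vec" and n r :: nat
    and il jl :: "nat list" and p :: "nat \<Rightarrow> nat \<Rightarrow> nat"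
  defines "M \<equiv> matM n r A b"
  defines "N \<equiv> submatrix (reduced n M il jl r) {..<n} (- set jl)"
  assumes A: "A \<in> carrier_mat r n" and b: "b \<in> carrier_vec r"
    and il: "length il = r" "distinct il" "set il \<subseteq> {..<r}"
    and jl: "length jl = r" "distinct jl" "set jl \<subseteq> {..<n}"
    and pivots: "\<And>k. k < r \<Longrightarrow> reduced n M il jl k $$ (n + il ! k, jl ! k) \<noteq> 0"
    and p_pos: "\<And>k j. k < r \<Longrightarrow> j \<in> {..<n} - set (take k jl) \<Longrightarrow> p k j > 0"
    and p_integral: "\<And>k j s. k < r \<Longrightarrow> j \<in> {..<n} - set (take k jl) \<Longrightarrow> s < n \<Longrightarrow>
           of_nat (p k j) * reduced n M il jl k $$ (s, j) \<in> \<int>"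
  shows "((iterated_CT n r M il jl p r :: 'k::field_char_0 frac_rat_fun) =
           of_int (sgn (det (mat r r (\<lambda>(s, t). A $$ (il ! s, jl ! t))))) *
           lattice_sigma n (shifted_cone N)) \<and>
         is_simplicial N"
proof -
  interpret elimination A b n r il jl
    using A il jl pivots by unfold_locales (simp_all add: M_def)
  let ?F = "iterated_CT n r M il jl p r :: 'k frac_rat_fun"
  let ?s = "sgn (det (mat r r (\<lambda>(s, t). A $$ (il ! s, jl ! t))))"
  have N: "N = cone_mat" by (simp add: N_def cone_mat_def R_def M_def)
  have signs: "(\<Prod>i<r. if piv i < 0 then - 1 else 1) = (of_int ?s :: 'k)"
  proof -
    let ?d = "det (mat r r (\<lambda>(s, t). A $$ (il ! s, jl ! t)))"
    have "(of_int ?d :: rat) \<noteq> 0"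
      unfolding of_int_det_eq_prod_piv using piv_neq_0 by auto
    then have "?d \<noteq> 0" by simp
    moreover have "(\<Prod>i<r. if piv i < 0 then - 1 else 1) = (if (of_int ?d :: rat) < 0 then - 1 else (1 :: 'k))"
      unfolding of_int_det_eq_prod_piv using piv_neq_0 by (intro prod_signs) auto
    ultimately show ?thesis by (simp add: sgn_if)
  qed
  \<comment> \<open>The pivots are nonzero, so the sign is 1 or -1 and its own inverse.\<close>
  have s: "of_int ?s * (of_int ?s :: 'a::ring_1) = 1"
  proof -
    have "?s * ?s = 1" using signs by (cases "?s = 0") (auto simp: sgn_if split: if_splits)
    then show ?thesis unfolding of_int_mult[symmetric] by simp
  qed
  have "represents (\<lambda>V. of_int ?s * lattice_series n (shifted_cone N) V) ?F"
    using represents_iterated_CT[of p r, where 'k='k] p_pos p_integral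
    unfolding signs N lattice_series_cone by (simp add: cols_def R_def M_def)
  \<comment> \<open>A second factor \<open>?s\<close> leaves the bare indicator series, the one in
    the definite description of \<open>lattice_sigma\<close>.\<close>
  then have "represents (\<lambda>V. of_int ?s * (of_int ?s * lattice_series n (shifted_cone N) V))
      (emb (Poly_Mapping.single 0 (of_int ?s)) * ?F)"
    by (rule represents_scale)
  moreover have "emb (Poly_Mapping.single 0 (of_int ?s)) = (of_int ?s :: 'k frac_rat_fun)"
    by (simp add: sgn_if One_fract_def Zero_fract_def)
  ultimately have "represents (lattice_series n (shifted_cone N)) (of_int ?s * ?F)"
    by (simp add: s flip: mult.assoc)
  then have "lattice_sigma n (shifted_cone N) = of_int ?s * ?F"
    unfolding lattice_sigma_def using represents_unique by blast
  then have "?F = of_int ?s * lattice_sigma n (shifted_cone N)"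
    by (simp add: s flip: mult.assoc)
  then show ?thesis
    using simplicial_cone_mat by (simp add: N)
qed

end
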